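(* Let $A$ be a Banach algebra that has a bounded left approximate identity $\{e_\lambda\}_{\lambda\in\Lambda}$ of bound $M\geq1$, let $X$ be a Banach space, and let $\pi$ be a continuous representation of $A$ on $X$. Let $S$ be a non-empty subset of $X$ such that $\lim_\lambda\pi(e_\lambda)s=s$ uniformly on $S$, and suppose that $S$ is bounded or that $\{e_\lambda\}_{\lambda\in\Lambda}$ is commutative. Let $\Omega$ be a directed set, and let $X'$ be the Banach space of all bounded convergent nets $f:\Omega\to X$, supplied with the supremum norm, or, alternatively, let $X'$ be the Banach space of all bounded nets $f:\Omega\to X$ that converge to zero, supplied with the supremum norm; in the latter case, assume that $0\in\overline S$. Let $\pi'$ be the natural continuous representation of $A$ on $X'$ by pointwise operations, $(\pi'(a)f)_\omega=\pi(a)f_\omega$, and let $S'$ be the set of all elements $\{f_\omega\}_{\omega\in\Omega}$ of $X'$ such that $f_\omega\in S$ for all $\omega\in\Omega$. Choose a unital Banach superalgebra $B$ of $A$ such that $\pi'$ extends to a continuous unital representation, again denoted by $\pi'$, of $B$ on $X'$. Then, for every $\epsilon>0$, every $\delta>0$, every $r$ with $0<r<(M+1)^{-1}$, every integer $n_0\geq1$, and every sequence $\{\alpha_n\}_{n=1}^\infty$ in $(1,\infty)$ with $\lim_{n\to\infty}\alpha_n=\infty$, there exists a simultaneous power factorization $(a,(x_n)_{n\geq1})$ (in the sense defined in the context) for the continuous representation $\sigma=\pi'$ on the Banach space $Y=X'$ with non-empty subset $T=S'$ of $X'$, the superalgebra $B$ and the parameters $\epsilon,\delta,r,n_0,\{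\alpha_n\}$.
   Context: All algebras and vector spaces are over $\mathbb F=\mathbb R$ or $\mathbb C$. Unit elements of unital normed algebras have norm $1$. A left approximate identity of bound $M$ for $A$ is a net $\{e_\lambda\}$ in $A$ with $\|e_\lambda\|\leq M$ and $\lim_\lambda e_\lambda a=a$ for all $a\in A$; it is commutative if its elements commute pairwise. A continuous representation on $X$ is a norm-continuous algebra homomorphism into the bounded operators on $X$; it is unital if it maps the unit to the identity operator. Uniform convergence $\lim_\lambda\pi(e_\lambda)s=s$ on $S$: for every $\eta>0$ there is $\lambda_0$ with $\|\pi(e_\lambda)s-s\|<\eta$ for all $\lambda\geq\lambda_0$, $s\in S$. A unital Banach superalgebra $B$ of $A$ is a unital Banach algebra containing $A$ as a closed subalgebra with the restricted norm. Definition (simultaneous power factorization). Let $A$ be a Banach algebra with left approximate identity $\{e_\lambda\}_{\lambda\in\Lambda}$ of bound $M\ge1$, $B$ a unital Banach superalgebra of $A$, $\sigma$ a continuous unital representation of $B$ on a Banach space $Y$, $T\subset Y$ non-empty, $\epsilon,\delta>0$, $0<r<(M+1)^{-1}$, $n_0\geq 1$ an integer, $\{\alpha_n\}$ a sequence in $(1,\infty)$ tending to $\infty$. A simultaneous power factorization for these data consists of $a\in A$ and maps $x_n:T\to Y$ ($n\geq 1$) such that: (1) $s=\sigma(a^n)x_n(s)$ for all $n\geq 1$, $s\in T$; (2) $\|a\|\leq M$; (3) for all $n\geq1$, $x_n$ is a uniformly continuous homeomorphism of $T$ onto $x_n(T)$, with the restricted map $\sigma(a^n):x_n(T)\to T$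 as its inverse; (4) (a) $\|s-x_n(s)\|\leq\epsilon$ for $1\leq n\leq n_0$ and $s\in T$; (b) $\|x_n(s)\|\leq\alpha_n^n\max(\|s\|,\delta)$ for all $n\geq1$, $s\in T$; (5) (a) if $s_1,s_2,s_1+s_2\in T$, then $x_n(s_1+s_2)=x_n(s_1)+x_n(s_2)$ for all $n\geq 1$; (b) if $\mu\in\mathbb F$ and $s,\mu s\in T$, then $x_n(\mu s)=\mu x_n(s)$ for all $n\geq 1$; (6) there is a sequence $\{u_i\}_{i=1}^\infty$ in $\{e_\lambda:\lambda\in\Lambda\}$ such that: (a) $a=\sum_{i=1}^\infty r(1-r)^{i-1}u_i$, an element of the closed convex hull of $\{u_i:i\geq1\}$ in $A$; (b) for every $k\geq0$, $b_k=(1-r)^k1_B+\sum_{i=1}^kr(1-r)^{i-1}u_i$ is an element of the convex hull of $\{1_B,u_1,\ldots,u_k\}$ in $B$ that is invertible in $B$, $b_k^{-1}$ lies in the unital Banach subalgebra of $B$ generated by $\{u_1,\ldots,u_k\}$ (smallest closed subalgebra containing these and $1_B$), and $x_n(s)=\lim_{k\to\infty}\sigma(b_k^{-n})s$ for all $n\geq1$, $s\in T$; (c) there is a chain $\lambda_1\leq\lambda_2\leq\ldots$ in $\Lambda$ with $u_k=e_{\lambda_k}$ for all $k\geq1$, where moreover $\lambda_1<\lambda_2<\ldots$ can be required if $\Lambda$ has no largest element; (7) (a) if $T$ is bounded, so is $x_n(T)$ for all $n\geq1$; (b) if $T$ is totally bounded, so is $x_n(T)$ for all $n\geq1$; (c)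 $\lim_\lambda\sigma(e_\lambda)x_n(s)=x_n(s)$ uniformly on $T$ for all $n\geq1$.
   Formalization: The set S' is not asserted to be non-empty: for nets converging to zero it can be empty even if 0 lies in the closure of S (e.g. Ω a single point, 0 not in S), so the factorization is defined and proved for T=S' whether or not it is empty. *)

theory Defs
  imports "HOL-Analysis.Analysis"
begin

section \<open>The scalar field\<close>

text \<open>The scalar field is a type that is isometrically isomorphic to \<open>\<real>\<close> or to \<open>\<complex>\<close>.\<close>

class real_or_complex = real_normed_field +
  assumes real_or_complex:
    "\<exists>h :: 'a \<Rightarrow> complex. (\<forall>x y. h (x + y) = h x + h y) \<and> (\<forall>x y. h (x * y) = h x * h y)
       \<and> (\<forall>x. cmod (h x) = norm x) \<and> (range h = \<real> \<or> range h = UNIV)"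

instance real :: real_or_complex
  by standard (rule exI[of _ complex_of_real], auto simp: Reals_def)

instance complex :: real_or_complex
  by standard (rule exI[of _ id], auto)

text \<open>The library's normed spaces carry real scalars only. The multiplication by the scalars of
  the field is therefore an explicit function, required to extend the real one.\<close>

definition normed_scaling :: "('f::real_or_complex \<Rightarrow> 'v::real_normed_vector \<Rightarrow> 'v) \<Rightarrow> bool" where
  "normed_scaling sc \<longleftrightarrow> vector_space sc
     \<and> (\<forall>t v. sc (of_real t) v = t *\<^sub>R v)
     \<and> (\<forall>c v. norm (sc c v) = norm c * norm v)"

definition normed_algebra_scaling ::
    "('f::real_or_complex \<Rightarrow> 'a::real_normed_algebra \<Rightarrow> 'a) \<Rightarrow> bool" where
  "normed_algebra_scaling sc \<longleftrightarrow> normed_scaling sc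
     \<and> (\<forall>c a b. sc c (a * b) = sc c a * b \<and> sc c (a * b) = a * sc c b)"

lemma normed_scaling_scaleR: "normed_scaling (scaleR :: real \<Rightarrow> 'v::real_normed_vector \<Rightarrow> 'v)"
  by (auto simp: normed_scaling_def intro!: vector_space.intro simp: scaleR_add_right scaleR_add_left)

lemma normed_scaling_bounded_linear:
  assumes "normed_scaling sc"
  shows "bounded_linear (sc c)"
proof (rule bounded_linear_intro)
  interpret vector_space sc using assms by (simp add: normed_scaling_def)
  have R: "t *\<^sub>R v = sc (of_real t) v" for t v
    using assms by (simp add: normed_scaling_def)
  show "sc c (x + y) = sc c x + sc c y" for x y by (rule scale_right_distrib)
  show "sc c (t *\<^sub>R x) = t *\<^sub>R sc c x" for t x by (simp add: R mult.commute)
  show "norm (sc c x) \<le> norm x * norm c" for x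
    using assms by (simp add: normed_scaling_def)
qed


section \<open>Directed sets and nets\<close>

class directed_preorder = preorder +
  assumes directed: "\<exists>z. x \<le> z \<and> y \<le> z"

instance nat :: directed_preorder
  by standard (meson linear order_refl)

text \<open>Convergence along a directed set is convergence along its filter of tails;
  the library's \<^const>\<open>at_top\<close> requires an antisymmetric order.\<close>

definition tails :: "'i::directed_preorder filter" where
  "tails = (INF k. principal {k..})"

lemma eventually_tails: "eventually P (tails :: 'i::directed_preorder filter) \<longleftrightarrow> (\<exists>k. \<forall>i\<ge>k. P i)"
proof -
  have "\<exists>x\<in>UNIV. principal {x..} \<le> inf (principal {a..}) (principal {b..})" for a b :: 'i
    using directed[of a b] by (auto intro: order_trans)
  then show ?thesis
    unfolding tails_def by (subst eventually_INF_base) (auto simp: eventually_principal)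
qed

lemma tails_neq_bot [simp]: "tails \<noteq> bot"
  unfolding trivial_limit_def eventually_tails by blast


section \<open>Banach spaces of nets\<close>

definition conv_nets :: "('w::directed_preorder \<Rightarrow> 'x::real_normed_vector) set" where
  "conv_nets = {f. bounded (range f) \<and> (\<exists>l. (f \<longlongrightarrow> l) tails)}"

definition null_nets :: "('w::directed_preorder \<Rightarrow> 'x::real_normed_vector) set" where
  "null_nets = {f. bounded (range f) \<and> (f \<longlongrightarrow> 0) tails}"

lemma norm_le_SUP: "bounded (range f) \<Longrightarrow> norm (f w) \<le> (SUP w. norm (f w))"
  by (rule cSUP_upper) (auto simp: bounded_iff bdd_above_def)

lemma uniform_limit_bounded_range:
  fixes f :: "nat \<Rightarrow> 'w \<Rightarrow> 'x::real_normed_vector"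
  assumes "uniform_limit UNIV f g sequentially" "\<And>n. bounded (range (f n))"
  shows "bounded (range g)"
proof -
  obtain N where N: "\<And>w. dist (f N w) (g w) < 1"
    using uniform_limitD[OF assms(1), of 1] by (auto simp: eventually_sequentially)
  obtain c where c: "\<And>w. norm (f N w) \<le> c"
    using assms(2)[of N] by (auto simp: bounded_iff)
  have "norm (g w) \<le> c + 1" for w
    using N[of w] c[of w] norm_triangle_ineq2[of "g w" "f N w"] by (simp add: dist_norm norm_minus_commute)
  then show ?thesis by (auto simp: bounded_iff)
qed

lemma uniform_limit_conv_nets:
  fixes f :: "nat \<Rightarrow> 'w::directed_preorder \<Rightarrow> 'x::banach"
  assumes u: "uniform_limit UNIV f g sequentially" and f: "\<And>n. f n \<in> conv_nets"
  shows "g \<in> conv_nets"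
proof -
  have "\<forall>n. \<exists>l. (f n \<longlongrightarrow> l) tails"
    using f by (auto simp: conv_nets_def)
  then obtain l where l: "\<And>n. (f n \<longlongrightarrow> l n) tails"
    by metis
  have "Cauchy l"
  proof (rule metric_CauchyI)
    fix e :: real assume "e > 0"
    then have "e / 2 > 0" by simp
    from uniform_limitD[OF u, of "e / 4"] \<open>e > 0\<close>
    obtain N where N: "\<And>n w. n \<ge> N \<Longrightarrow> dist (f n w) (g w) < e / 4"
      by (auto simp: eventually_sequentially)
    have "dist (l m) (l n) < e" if "m \<ge> N" "n \<ge> N" for m n
    proof -
      have "dist (f m w) (f n w) \<le> e / 2" for w
        using N[OF that(1), of w] N[OF that(2), of w] dist_triangle2[of "f m w" "f n w" "g w"]
        by simp
      then have "dist (l m) (l n) \<le> e / 2"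
        by (intro tendsto_upperbound[OF tendsto_dist[OF l l]]) auto
      with \<open>e > 0\<close> show ?thesis by simp
    qed
    then show "\<exists>M. \<forall>m\<ge>M. \<forall>n\<ge>M. dist (l m) (l n) < e" by blast
  qed
  then obtain L where "l \<longlonglongrightarrow> L" by (auto simp: Cauchy_convergent_iff convergent_def)
  then have "(g \<longlongrightarrow> L) tails"
    by (intro swap_uniform_limit'[OF _ _ u]) (auto simp: l)
  with uniform_limit_bounded_range[OF u] f show ?thesis
    by (auto simp: conv_nets_def)
qed

lemma uniform_limit_null_nets:
  fixes f :: "nat \<Rightarrow> 'w::directed_preorder \<Rightarrow> 'x::banach"
  assumes u: "uniform_limit UNIV f g sequentially" and f: "\<And>n. f n \<in> null_nets"
  shows "g \<in> null_nets"
proof -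
  have "(g \<longlongrightarrow> 0) tails"
    using f by (intro swap_uniform_limit'[OF _ tendsto_const u]) (auto simp: null_nets_def)
  with uniform_limit_bounded_range[OF u] f show ?thesis
    by (auto simp: null_nets_def)
qed

lemma conv_nets_closed:
  shows "(\<lambda>_. 0) \<in> conv_nets"
    and "f \<in> conv_nets \<Longrightarrow> g \<in> conv_nets \<Longrightarrow> (\<lambda>w. f w + g w) \<in> conv_nets"
    and "f \<in> conv_nets \<Longrightarrow> g \<in> conv_nets \<Longrightarrow> (\<lambda>w. f w - g w) \<in> conv_nets"
    and "bounded_linear h \<Longrightarrow> f \<in> conv_nets \<Longrightarrow> (\<lambda>w. h (f w)) \<in> conv_nets"
  unfolding conv_nets_def
     apply (auto simp: image_def intro: tendsto_const)[]
    apply (auto intro!: bounded_plus_comp intro: tendsto_add)[]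
   apply (auto intro!: bounded_minus_comp intro: tendsto_diff)[]
  using bounded_linear_image[of "range f" h]
  apply (auto simp: image_image dest: bounded_linear.tendsto)
  done

lemma null_nets_closed:
  shows "(\<lambda>_. 0) \<in> null_nets"
    and "f \<in> null_nets \<Longrightarrow> g \<in> null_nets \<Longrightarrow> (\<lambda>w. f w + g w) \<in> null_nets"
    and "f \<in> null_nets \<Longrightarrow> g \<in> null_nets \<Longrightarrow> (\<lambda>w. f w - g w) \<in> null_nets"
    and "bounded_linear h \<Longrightarrow> f \<in> null_nets \<Longrightarrow> (\<lambda>w. h (f w)) \<in> null_nets"
  unfolding null_nets_def
     apply (auto simp: image_def)[]
    apply (auto intro!: bounded_plus_comp tendsto_add_zero)[]
   apply (auto intro!: bounded_minus_comp dest: tendsto_diff)[]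
  using bounded_linear_image[of "range f" h]
  apply (auto simp: image_image intro: bounded_linear.tendsto_zero)
  done


subsection \<open>Bounded convergent nets\<close>

typedef (overloaded) ('w::directed_preorder, 'x::real_normed_vector) conv_net =
  "conv_nets :: ('w \<Rightarrow> 'x) set"
  morphisms apply_conv_net Abs_conv_net
  using conv_nets_closed(1) by blast

setup_lifting type_definition_conv_net

lemma conv_net_eqI: "(\<And>w. apply_conv_net f w = apply_conv_net g w) \<Longrightarrow> f = g"
  by transfer auto

lemma bounded_apply_conv_net: "bounded (range (apply_conv_net f))"
  using apply_conv_net[of f] by (simp add: conv_nets_def)

instantiation conv_net :: (directed_preorder, real_normed_vector) real_normed_vector
begin

lift_definition zero_conv_net :: "('a, 'b) conv_net" is "\<lambda>_. 0"
  by (rule conv_nets_closed)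

lift_definition plus_conv_net :: "('a, 'b) conv_net \<Rightarrow> ('a, 'b) conv_net \<Rightarrow> ('a, 'b) conv_net"
  is "\<lambda>f g w. f w + g w"
  by (rule conv_nets_closed)

lift_definition minus_conv_net :: "('a, 'b) conv_net \<Rightarrow> ('a, 'b) conv_net \<Rightarrow> ('a, 'b) conv_net"
  is "\<lambda>f g w. f w - g w"
  by (rule conv_nets_closed)

lift_definition uminus_conv_net :: "('a, 'b) conv_net \<Rightarrow> ('a, 'b) conv_net" is "\<lambda>f w. - f w"
  by (rule conv_nets_closed(4)[OF bounded_linear_minus[OF bounded_linear_ident]])

lift_definition scaleR_conv_net :: "real \<Rightarrow> ('a, 'b) conv_net \<Rightarrow> ('a, 'b) conv_net"
  is "\<lambda>t f w. t *\<^sub>R f w"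
  by (rule conv_nets_closed(4)[OF bounded_linear_scaleR_right])

lift_definition norm_conv_net :: "('a, 'b) conv_net \<Rightarrow> real" is "\<lambda>f. SUP w. norm (f w)" .

definition sgn_conv_net :: "('a, 'b) conv_net \<Rightarrow> ('a, 'b) conv_net" where
  "sgn_conv_net f = inverse (norm f) *\<^sub>R f"

definition dist_conv_net :: "('a, 'b) conv_net \<Rightarrow> ('a, 'b) conv_net \<Rightarrow> real" where
  "dist_conv_net f g = norm (f - g)"

definition uniformity_conv_net :: "(('a, 'b) conv_net \<times> ('a, 'b) conv_net) filter" where
  "uniformity_conv_net = (INF e\<in>{0 <..}. principal {(f, g). dist f g < e})"

definition open_conv_net :: "('a, 'b) conv_net set \<Rightarrow> bool" where
  "open_conv_net U = (\<forall>f\<in>U. \<forall>\<^sub>F (f', g) in uniformity. f' = f \<longrightarrow> g \<in> U)"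

lemmas conv_net_rep_eq = zero_conv_net.rep_eq plus_conv_net.rep_eq minus_conv_net.rep_eq
  uminus_conv_net.rep_eq scaleR_conv_net.rep_eq

lemma norm_apply_conv_net: "norm (apply_conv_net f w) \<le> norm f"
  unfolding norm_conv_net.rep_eq by (rule norm_le_SUP[OF bounded_apply_conv_net])

lemma norm_conv_net_le: "(\<And>w. norm (apply_conv_net f w) \<le> c) \<Longrightarrow> norm f \<le> c"
  unfolding norm_conv_net.rep_eq by (rule cSUP_least) auto

instance
proof
  fix f g h :: "('a, 'b) conv_net" and s t :: real
  show "f + g + h = f + (g + h)" "f + g = g + f" "0 + f = f" "- f + f = 0" "f - g = f + - g"
    "t *\<^sub>R (f + g) = t *\<^sub>R f + t *\<^sub>R g" "(s + t) *\<^sub>R f = s *\<^sub>R f + t *\<^sub>R f"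
    "s *\<^sub>R t *\<^sub>R f = (s * t) *\<^sub>R f" "1 *\<^sub>R f = f"
    by (auto intro!: conv_net_eqI simp: conv_net_rep_eq algebra_simps)
  have nonneg: "0 \<le> norm k" for k :: "('a, 'b) conv_net"
    by (rule order_trans[OF norm_ge_zero norm_apply_conv_net])
  show "(norm f = 0) = (f = 0)"
  proof
    assume "norm f = 0"
    then show "f = 0"
      using norm_apply_conv_net[of f] by (auto intro!: conv_net_eqI simp: conv_net_rep_eq)
  next
    assume "f = 0"
    then have "norm f \<le> 0" by (intro norm_conv_net_le) (simp add: conv_net_rep_eq)
    with nonneg[of f] show "norm f = 0" by simp
  qed
  show "norm (f + g) \<le> norm f + norm g"
    by (rule norm_conv_net_le)
      (auto simp: conv_net_rep_eq intro!: norm_triangle_mono norm_apply_conv_net)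
  have le: "norm (t *\<^sub>R k) \<le> \<bar>t\<bar> * norm k" for t and k :: "('a, 'b) conv_net"
    by (rule norm_conv_net_le)
      (auto simp: conv_net_rep_eq intro!: mult_left_mono norm_apply_conv_net)
  show "norm (t *\<^sub>R f) = \<bar>t\<bar> * norm f"
  proof (cases "t = 0")
    case True
    then show ?thesis using le[of t f] nonneg[of "t *\<^sub>R f"] by simp
  next
    case False
    have "inverse t *\<^sub>R t *\<^sub>R f = f"
      using False by (auto intro!: conv_net_eqI simp: conv_net_rep_eq)
    then have "norm f \<le> \<bar>inverse t\<bar> * norm (t *\<^sub>R f)"
      using le[of "inverse t" "t *\<^sub>R f"] by simp
    then have "\<bar>t\<bar> * norm f \<le> norm (t *\<^sub>R f)"
      using False by (simp add: field_simps)
    with le[of t f] show ?thesis by simp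
  qed
qed (rule dist_conv_net_def sgn_conv_net_def open_conv_net_def uniformity_conv_net_def)+

end

instance conv_net :: (directed_preorder, banach) banach
proof
  fix F :: "nat \<Rightarrow> ('a, 'b) conv_net"
  assume F: "Cauchy F"
  have d: "dist (apply_conv_net f w) (apply_conv_net g w) \<le> dist f g" for f g :: "('a, 'b) conv_net" and w
    using norm_apply_conv_net[of "f - g" w] by (simp add: dist_norm conv_net_rep_eq)
  have "uniformly_Cauchy_on UNIV (\<lambda>n. apply_conv_net (F n))"
    using F d unfolding Cauchy_def uniformly_Cauchy_on_def by (meson le_less_trans)
  then obtain g where g: "uniform_limit UNIV (\<lambda>n. apply_conv_net (F n)) g sequentially"
    using Cauchy_uniformly_convergent by (auto simp: uniformly_convergent_on_def)
  then have "g \<in> conv_nets" by (rule uniform_limit_conv_nets) (rule apply_conv_net)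
  then obtain G where G: "g = apply_conv_net G" by (metis Abs_conv_net_inverse)
  have "F \<longlonglongrightarrow> G"
  proof (rule tendstoI)
    fix e :: real assume "e > 0"
    then have "\<forall>\<^sub>F n in sequentially. \<forall>w\<in>UNIV. dist (apply_conv_net (F n) w) (g w) < e / 2"
      by (intro uniform_limitD[OF g]) simp
    then show "\<forall>\<^sub>F n in sequentially. dist (F n) G < e"
    proof eventually_elim
      case (elim n)
      then have "norm (F n - G) \<le> e / 2"
        by (intro norm_conv_net_le) (auto simp: conv_net_rep_eq G dist_norm intro: less_imp_le)
      with \<open>e > 0\<close> show ?case by (simp add: dist_norm)
    qed
  qed
  then show "convergent F" by (rule convergentI)
qed

text \<open>Pointwise application of a bounded linear map (the abstraction is arbitrary for other maps).\<close>

definition conv_net_map ::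
    "('x \<Rightarrow> 'x) \<Rightarrow> ('w::directed_preorder, 'x::real_normed_vector) conv_net \<Rightarrow> ('w, 'x) conv_net" where
  "conv_net_map h f = Abs_conv_net (\<lambda>w. h (apply_conv_net f w))"

lemma apply_conv_net_map:
  "bounded_linear h \<Longrightarrow> apply_conv_net (conv_net_map h f) w = h (apply_conv_net f w)"
  unfolding conv_net_map_def
  by (subst Abs_conv_net_inverse) (auto intro: conv_nets_closed(4) apply_conv_net)

lemma bounded_linear_conv_net_map:
  assumes h: "bounded_linear h"
  shows "bounded_linear (conv_net_map h)"
proof -
  interpret bounded_linear h by (rule h)
  obtain C where "C \<ge> 0" and C: "\<And>x. norm (h x) \<le> norm x * C" using nonneg_bounded by blast
  show ?thesis
  proof (rule bounded_linear_intro)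
    show "conv_net_map h (f + g) = conv_net_map h f + conv_net_map h g" for f g
      by (rule conv_net_eqI) (simp add: apply_conv_net_map[OF h] conv_net_rep_eq add)
    show "conv_net_map h (t *\<^sub>R f) = t *\<^sub>R conv_net_map h f" for t f
      by (rule conv_net_eqI) (simp add: apply_conv_net_map[OF h] conv_net_rep_eq scaleR)
    show "norm (conv_net_map h f) \<le> norm f * C" for f
      by (rule norm_conv_net_le, subst apply_conv_net_map[OF h], rule order_trans[OF C])
        (rule mult_right_mono[OF norm_apply_conv_net \<open>C \<ge> 0\<close>])
  qed
qed

definition conv_net_op ::
    "('x \<Rightarrow>\<^sub>L 'x) \<Rightarrow> ('w::directed_preorder, 'x::real_normed_vector) conv_net \<Rightarrow>\<^sub>L ('w, 'x) conv_net" where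
  "conv_net_op T = Blinfun (conv_net_map (blinfun_apply T))"

lemma apply_conv_net_op: "apply_conv_net (conv_net_op T f) w = T (apply_conv_net f w)"
  unfolding conv_net_op_def
  by (simp add: bounded_linear_Blinfun_apply bounded_linear_conv_net_map blinfun.bounded_linear_right
      apply_conv_net_map)

definition conv_net_scale ::
    "('f \<Rightarrow> 'x \<Rightarrow> 'x) \<Rightarrow> 'f \<Rightarrow> ('w::directed_preorder, 'x::real_normed_vector) conv_net \<Rightarrow> ('w, 'x) conv_net" where
  "conv_net_scale sc c = conv_net_map (sc c)"

lemma normed_scaling_conv_net:
  assumes sc: "normed_scaling (sc :: 'f::real_or_complex \<Rightarrow> 'x::real_normed_vector \<Rightarrow> 'x)"
  shows "normed_scaling (conv_net_scale sc :: 'f \<Rightarrow> ('w::directed_preorder, 'x) conv_net \<Rightarrow> ('w, 'x) conv_net)"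
proof -
  interpret vector_space sc using sc by (simp add: normed_scaling_def)
  note ap = apply_conv_net_map[OF normed_scaling_bounded_linear[OF sc]]
  have n: "norm (sc c v) = norm c * norm v" for c v using sc by (simp add: normed_scaling_def)
  have vs: "vector_space (conv_net_scale sc :: 'f \<Rightarrow> ('w, 'x) conv_net \<Rightarrow> ('w, 'x) conv_net)"
    by (rule vector_space.intro)
      (auto intro!: conv_net_eqI simp: conv_net_scale_def ap conv_net_rep_eq
        scale_right_distrib scale_left_distrib)
  interpret V: vector_space "conv_net_scale sc :: 'f \<Rightarrow> ('w, 'x) conv_net \<Rightarrow> ('w, 'x) conv_net" by (rule vs)
  have le: "norm (conv_net_scale sc c f) \<le> norm c * norm f" for c and f :: "('w, 'x) conv_net"
    by (rule norm_conv_net_le)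
      (auto simp: conv_net_scale_def ap n intro!: mult_left_mono norm_apply_conv_net)
  have "norm (conv_net_scale sc c f) = norm c * norm f" for c and f :: "('w, 'x) conv_net"
  proof (cases "c = 0")
    case False
    then have "norm f \<le> norm (inverse c) * norm (conv_net_scale sc c f)"
      using le[of "inverse c" "conv_net_scale sc c f"] by simp
    then have "norm f \<le> norm (conv_net_scale sc c f) / norm c"
      by (simp only: norm_inverse divide_inverse mult.commute)
    then have "norm c * norm f \<le> norm (conv_net_scale sc c f)"
      using False by (simp add: pos_le_divide_eq mult.commute)
    with le[of c f] show ?thesis by simp
  qed simp
  moreover have "conv_net_scale sc (of_real t) f = t *\<^sub>R f" for t and f :: "('w, 'x) conv_net"
    using sc by (intro conv_net_eqI) (simp add: conv_net_scale_def ap conv_net_rep_eq normed_scaling_def)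
  ultimately show ?thesis using vs by (simp add: normed_scaling_def)
qed

definition conv_nets_in :: "'x set \<Rightarrow> ('w::directed_preorder, 'x::real_normed_vector) conv_net set" where
  "conv_nets_in S = {f. \<forall>w. apply_conv_net f w \<in> S}"


subsection \<open>Bounded nets converging to zero\<close>

typedef (overloaded) ('w::directed_preorder, 'x::real_normed_vector) null_net =
  "null_nets :: ('w \<Rightarrow> 'x) set"
  morphisms apply_null_net Abs_null_net
  using null_nets_closed(1) by blast

setup_lifting type_definition_null_net

lemma null_net_eqI: "(\<And>w. apply_null_net f w = apply_null_net g w) \<Longrightarrow> f = g"
  by transfer auto

lemma bounded_apply_null_net: "bounded (range (apply_null_net f))"
  using apply_null_net[of f] by (simp add: null_nets_def)

instantiation null_net :: (directed_preorder, real_normed_vector) real_normed_vector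
begin

lift_definition zero_null_net :: "('a, 'b) null_net" is "\<lambda>_. 0"
  by (rule null_nets_closed)

lift_definition plus_null_net :: "('a, 'b) null_net \<Rightarrow> ('a, 'b) null_net \<Rightarrow> ('a, 'b) null_net"
  is "\<lambda>f g w. f w + g w"
  by (rule null_nets_closed)

lift_definition minus_null_net :: "('a, 'b) null_net \<Rightarrow> ('a, 'b) null_net \<Rightarrow> ('a, 'b) null_net"
  is "\<lambda>f g w. f w - g w"
  by (rule null_nets_closed)

lift_definition uminus_null_net :: "('a, 'b) null_net \<Rightarrow> ('a, 'b) null_net" is "\<lambda>f w. - f w"
  by (rule null_nets_closed(4)[OF bounded_linear_minus[OF bounded_linear_ident]])

lift_definition scaleR_null_net :: "real \<Rightarrow> ('a, 'b) null_net \<Rightarrow> ('a, 'b) null_net"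
  is "\<lambda>t f w. t *\<^sub>R f w"
  by (rule null_nets_closed(4)[OF bounded_linear_scaleR_right])

lift_definition norm_null_net :: "('a, 'b) null_net \<Rightarrow> real" is "\<lambda>f. SUP w. norm (f w)" .

definition sgn_null_net :: "('a, 'b) null_net \<Rightarrow> ('a, 'b) null_net" where
  "sgn_null_net f = inverse (norm f) *\<^sub>R f"

definition dist_null_net :: "('a, 'b) null_net \<Rightarrow> ('a, 'b) null_net \<Rightarrow> real" where
  "dist_null_net f g = norm (f - g)"

definition uniformity_null_net :: "(('a, 'b) null_net \<times> ('a, 'b) null_net) filter" where
  "uniformity_null_net = (INF e\<in>{0 <..}. principal {(f, g). dist f g < e})"

definition open_null_net :: "('a, 'b) null_net set \<Rightarrow> bool" where
  "open_null_net U = (\<forall>f\<in>U. \<forall>\<^sub>F (f', g) in uniformity. f' = f \<longrightarrow> g \<in> U)"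

lemmas null_net_rep_eq = zero_null_net.rep_eq plus_null_net.rep_eq minus_null_net.rep_eq
  uminus_null_net.rep_eq scaleR_null_net.rep_eq

lemma norm_apply_null_net: "norm (apply_null_net f w) \<le> norm f"
  unfolding norm_null_net.rep_eq by (rule norm_le_SUP[OF bounded_apply_null_net])

lemma norm_null_net_le: "(\<And>w. norm (apply_null_net f w) \<le> c) \<Longrightarrow> norm f \<le> c"
  unfolding norm_null_net.rep_eq by (rule cSUP_least) auto

instance
proof
  fix f g h :: "('a, 'b) null_net" and s t :: real
  show "f + g + h = f + (g + h)" "f + g = g + f" "0 + f = f" "- f + f = 0" "f - g = f + - g"
    "t *\<^sub>R (f + g) = t *\<^sub>R f + t *\<^sub>R g" "(s + t) *\<^sub>R f = s *\<^sub>R f + t *\<^sub>R f"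
    "s *\<^sub>R t *\<^sub>R f = (s * t) *\<^sub>R f" "1 *\<^sub>R f = f"
    by (auto intro!: null_net_eqI simp: null_net_rep_eq algebra_simps)
  have nonneg: "0 \<le> norm k" for k :: "('a, 'b) null_net"
    by (rule order_trans[OF norm_ge_zero norm_apply_null_net])
  show "(norm f = 0) = (f = 0)"
  proof
    assume "norm f = 0"
    then show "f = 0"
      using norm_apply_null_net[of f] by (auto intro!: null_net_eqI simp: null_net_rep_eq)
  next
    assume "f = 0"
    then have "norm f \<le> 0" by (intro norm_null_net_le) (simp add: null_net_rep_eq)
    with nonneg[of f] show "norm f = 0" by simp
  qed
  show "norm (f + g) \<le> norm f + norm g"
    by (rule norm_null_net_le)
      (auto simp: null_net_rep_eq intro!: norm_triangle_mono norm_apply_null_net)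
  have le: "norm (t *\<^sub>R k) \<le> \<bar>t\<bar> * norm k" for t and k :: "('a, 'b) null_net"
    by (rule norm_null_net_le)
      (auto simp: null_net_rep_eq intro!: mult_left_mono norm_apply_null_net)
  show "norm (t *\<^sub>R f) = \<bar>t\<bar> * norm f"
  proof (cases "t = 0")
    case True
    then show ?thesis using le[of t f] nonneg[of "t *\<^sub>R f"] by simp
  next
    case False
    have "inverse t *\<^sub>R t *\<^sub>R f = f"
      using False by (auto intro!: null_net_eqI simp: null_net_rep_eq)
    then have "norm f \<le> \<bar>inverse t\<bar> * norm (t *\<^sub>R f)"
      using le[of "inverse t" "t *\<^sub>R f"] by simp
    then have "\<bar>t\<bar> * norm f \<le> norm (t *\<^sub>R f)"
      using False by (simp add: field_simps)
    with le[of t f] show ?thesis by simp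
  qed
qed (rule dist_null_net_def sgn_null_net_def open_null_net_def uniformity_null_net_def)+

end

instance null_net :: (directed_preorder, banach) banach
proof
  fix F :: "nat \<Rightarrow> ('a, 'b) null_net"
  assume F: "Cauchy F"
  have d: "dist (apply_null_net f w) (apply_null_net g w) \<le> dist f g" for f g :: "('a, 'b) null_net" and w
    using norm_apply_null_net[of "f - g" w] by (simp add: dist_norm null_net_rep_eq)
  have "uniformly_Cauchy_on UNIV (\<lambda>n. apply_null_net (F n))"
    using F d unfolding Cauchy_def uniformly_Cauchy_on_def by (meson le_less_trans)
  then obtain g where g: "uniform_limit UNIV (\<lambda>n. apply_null_net (F n)) g sequentially"
    using Cauchy_uniformly_convergent by (auto simp: uniformly_convergent_on_def)
  then have "g \<in> null_nets" by (rule uniform_limit_null_nets) (rule apply_null_net)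
  then obtain G where G: "g = apply_null_net G" by (metis Abs_null_net_inverse)
  have "F \<longlonglongrightarrow> G"
  proof (rule tendstoI)
    fix e :: real assume "e > 0"
    then have "\<forall>\<^sub>F n in sequentially. \<forall>w\<in>UNIV. dist (apply_null_net (F n) w) (g w) < e / 2"
      by (intro uniform_limitD[OF g]) simp
    then show "\<forall>\<^sub>F n in sequentially. dist (F n) G < e"
    proof eventually_elim
      case (elim n)
      then have "norm (F n - G) \<le> e / 2"
        by (intro norm_null_net_le) (auto simp: null_net_rep_eq G dist_norm intro: less_imp_le)
      with \<open>e > 0\<close> show ?case by (simp add: dist_norm)
    qed
  qed
  then show "convergent F" by (rule convergentI)
qed

text \<open>Pointwise application of a bounded linear map (the abstraction is arbitrary for other maps).\<close>

definition null_net_map ::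
    "('x \<Rightarrow> 'x) \<Rightarrow> ('w::directed_preorder, 'x::real_normed_vector) null_net \<Rightarrow> ('w, 'x) null_net" where
  "null_net_map h f = Abs_null_net (\<lambda>w. h (apply_null_net f w))"

lemma apply_null_net_map:
  "bounded_linear h \<Longrightarrow> apply_null_net (null_net_map h f) w = h (apply_null_net f w)"
  unfolding null_net_map_def
  by (subst Abs_null_net_inverse) (auto intro: null_nets_closed(4) apply_null_net)

lemma bounded_linear_null_net_map:
  assumes h: "bounded_linear h"
  shows "bounded_linear (null_net_map h)"
proof -
  interpret bounded_linear h by (rule h)
  obtain C where "C \<ge> 0" and C: "\<And>x. norm (h x) \<le> norm x * C" using nonneg_bounded by blast
  show ?thesis
  proof (rule bounded_linear_intro)
    show "null_net_map h (f + g) = null_net_map h f + null_net_map h g" for f g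
      by (rule null_net_eqI) (simp add: apply_null_net_map[OF h] null_net_rep_eq add)
    show "null_net_map h (t *\<^sub>R f) = t *\<^sub>R null_net_map h f" for t f
      by (rule null_net_eqI) (simp add: apply_null_net_map[OF h] null_net_rep_eq scaleR)
    show "norm (null_net_map h f) \<le> norm f * C" for f
      by (rule norm_null_net_le, subst apply_null_net_map[OF h], rule order_trans[OF C])
        (rule mult_right_mono[OF norm_apply_null_net \<open>C \<ge> 0\<close>])
  qed
qed

definition null_net_op ::
    "('x \<Rightarrow>\<^sub>L 'x) \<Rightarrow> ('w::directed_preorder, 'x::real_normed_vector) null_net \<Rightarrow>\<^sub>L ('w, 'x) null_net" where
  "null_net_op T = Blinfun (null_net_map (blinfun_apply T))"

lemma apply_null_net_op: "apply_null_net (null_net_op T f) w = T (apply_null_net f w)"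
  unfolding null_net_op_def
  by (simp add: bounded_linear_Blinfun_apply bounded_linear_null_net_map blinfun.bounded_linear_right
      apply_null_net_map)

definition null_net_scale ::
    "('f \<Rightarrow> 'x \<Rightarrow> 'x) \<Rightarrow> 'f \<Rightarrow> ('w::directed_preorder, 'x::real_normed_vector) null_net \<Rightarrow> ('w, 'x) null_net" where
  "null_net_scale sc c = null_net_map (sc c)"

lemma normed_scaling_null_net:
  assumes sc: "normed_scaling (sc :: 'f::real_or_complex \<Rightarrow> 'x::real_normed_vector \<Rightarrow> 'x)"
  shows "normed_scaling (null_net_scale sc :: 'f \<Rightarrow> ('w::directed_preorder, 'x) null_net \<Rightarrow> ('w, 'x) null_net)"
proof -
  interpret vector_space sc using sc by (simp add: normed_scaling_def)
  note ap = apply_null_net_map[OF normed_scaling_bounded_linear[OF sc]]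
  have n: "norm (sc c v) = norm c * norm v" for c v using sc by (simp add: normed_scaling_def)
  have vs: "vector_space (null_net_scale sc :: 'f \<Rightarrow> ('w, 'x) null_net \<Rightarrow> ('w, 'x) null_net)"
    by (rule vector_space.intro)
      (auto intro!: null_net_eqI simp: null_net_scale_def ap null_net_rep_eq
        scale_right_distrib scale_left_distrib)
  interpret V: vector_space "null_net_scale sc :: 'f \<Rightarrow> ('w, 'x) null_net \<Rightarrow> ('w, 'x) null_net" by (rule vs)
  have le: "norm (null_net_scale sc c f) \<le> norm c * norm f" for c and f :: "('w, 'x) null_net"
    by (rule norm_null_net_le)
      (auto simp: null_net_scale_def ap n intro!: mult_left_mono norm_apply_null_net)
  have "norm (null_net_scale sc c f) = norm c * norm f" for c and f :: "('w, 'x) null_net"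
  proof (cases "c = 0")
    case False
    then have "norm f \<le> norm (inverse c) * norm (null_net_scale sc c f)"
      using le[of "inverse c" "null_net_scale sc c f"] by simp
    then have "norm f \<le> norm (null_net_scale sc c f) / norm c"
      by (simp only: norm_inverse divide_inverse mult.commute)
    then have "norm c * norm f \<le> norm (null_net_scale sc c f)"
      using False by (simp add: pos_le_divide_eq mult.commute)
    with le[of c f] show ?thesis by simp
  qed simp
  moreover have "null_net_scale sc (of_real t) f = t *\<^sub>R f" for t and f :: "('w, 'x) null_net"
    using sc by (intro null_net_eqI) (simp add: null_net_scale_def ap null_net_rep_eq normed_scaling_def)
  ultimately show ?thesis using vs by (simp add: normed_scaling_def)
qed

definition null_nets_in :: "'x set \<Rightarrow> ('w::directed_preorder, 'x::real_normed_vector) null_net set" where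
  "null_nets_in S = {f. \<forall>w. apply_null_net f w \<in> S}"


lemma conv_nets_in_nonempty:
  assumes "S \<noteq> {}"
  shows "(conv_nets_in S :: ('w::directed_preorder, 'x::real_normed_vector) conv_net set) \<noteq> {}"
proof -
  obtain s where s: "s \<in> S" using assms by blast
  have "(\<lambda>_::'w. s) \<in> conv_nets"
    by (auto simp: conv_nets_def image_def intro: tendsto_const)
  then have "Abs_conv_net (\<lambda>_. s) \<in> (conv_nets_in S :: ('w, 'x) conv_net set)"
    using s by (simp add: conv_nets_in_def Abs_conv_net_inverse)
  then show ?thesis by blast
qed

section \<open>Approximate identities, representations and superalgebras\<close>

definition left_approximate_identity ::
    "('l::directed_preorder \<Rightarrow> 'a::real_normed_algebra) \<Rightarrow> real \<Rightarrow> bool" where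
  "left_approximate_identity e M \<longleftrightarrow>
     (\<forall>l. norm (e l) \<le> M) \<and> (\<forall>a. ((\<lambda>l. e l * a) \<longlongrightarrow> a) tails)"

text \<open>Operators \<open>'x \<Rightarrow>\<^sub>L 'x\<close> are bounded and real linear; linearity over the scalar field is the
  first requirement.\<close>

definition continuous_representation ::
    "('f::real_or_complex \<Rightarrow> 'a::real_normed_algebra \<Rightarrow> 'a) \<Rightarrow>
     ('f \<Rightarrow> 'x::real_normed_vector \<Rightarrow> 'x) \<Rightarrow> ('a \<Rightarrow> 'x \<Rightarrow>\<^sub>L 'x) \<Rightarrow> bool" where
  "continuous_representation scA scX \<pi> \<longleftrightarrow>
     (\<forall>a. Vector_Spaces.linear scX scX (blinfun_apply (\<pi> a)))
     \<and> (\<forall>a b. \<pi> (a + b) = \<pi> a + \<pi> b)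
     \<and> (\<forall>c a x. \<pi> (scA c a) x = scX c (\<pi> a x))
     \<and> (\<forall>a b. \<pi> (a * b) = \<pi> a o\<^sub>L \<pi> b)
     \<and> continuous_on UNIV \<pi>"

definition continuous_unital_representation ::
    "('f::real_or_complex \<Rightarrow> 'b::real_normed_algebra_1 \<Rightarrow> 'b) \<Rightarrow>
     ('f \<Rightarrow> 'x::real_normed_vector \<Rightarrow> 'x) \<Rightarrow> ('b \<Rightarrow> 'x \<Rightarrow>\<^sub>L 'x) \<Rightarrow> bool" where
  "continuous_unital_representation scB scX \<sigma> \<longleftrightarrow>
     continuous_representation scB scX \<sigma> \<and> \<sigma> 1 = id_blinfun"

text \<open>The inclusion of \<open>A\<close> into a superalgebra \<open>B\<close> is an explicit isometric embedding \<open>\<iota>\<close>.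
  The unit of \<open>B\<close> has norm 1 by the class \<^class>\<open>real_normed_algebra_1\<close>.\<close>

definition unital_superalgebra ::
    "('f::real_or_complex \<Rightarrow> 'a::real_normed_algebra \<Rightarrow> 'a) \<Rightarrow>
     ('f \<Rightarrow> 'b::real_normed_algebra_1 \<Rightarrow> 'b) \<Rightarrow> ('a \<Rightarrow> 'b) \<Rightarrow> bool" where
  "unital_superalgebra scA scB \<iota> \<longleftrightarrow>
     normed_algebra_scaling scB
     \<and> Vector_Spaces.linear scA scB \<iota>
     \<and> (\<forall>a a'. \<iota> (a * a') = \<iota> a * \<iota> a')
     \<and> (\<forall>a. norm (\<iota> a) = norm a)
     \<and> closed (range \<iota>)"

definition generated_unital_subalgebra ::
    "('f::real_or_complex \<Rightarrow> 'b::real_normed_algebra_1 \<Rightarrow> 'b) \<Rightarrow> 'b set \<Rightarrow> 'b set" where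
  "generated_unital_subalgebra scB G =
     \<Inter> {C. G \<subseteq> C \<and> 1 \<in> C \<and> module.subspace scB C \<and> (\<forall>b\<in>C. \<forall>c\<in>C. b * c \<in> C) \<and> closed C}"


section \<open>Simultaneous power factorization\<close>

text \<open>The powers \<open>a\<^sup>n\<close> (with \<open>n \<ge> 1\<close>) are formed in \<open>B\<close>, since \<open>A\<close> need not have a unit.
  Sequences are indexed from 1; their value at 0 is irrelevant. In the existential clause, \<open>bi k\<close> is the inverse
  of \<open>b\<^sub>k\<close> in \<open>B\<close>, and the \<open>i\<close>-th term of the series for \<open>a\<close> is shifted to index \<open>i - 1\<close>. The set \<open>T\<close> may
  be empty, since there need be no net in \<open>S\<close> that converges to 0 along a given directed set even
  if \<open>0\<close> is in the closure of \<open>S\<close>.\<close>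

definition simultaneous_power_factorization ::
    "('f::real_or_complex \<Rightarrow> 'b::{real_normed_algebra_1, banach} \<Rightarrow> 'b) \<Rightarrow>
     ('f \<Rightarrow> 'y::banach \<Rightarrow> 'y) \<Rightarrow>
     ('l::directed_preorder \<Rightarrow> 'a::{real_normed_algebra, banach}) \<Rightarrow> real \<Rightarrow>
     ('a \<Rightarrow> 'b) \<Rightarrow> ('b \<Rightarrow> 'y \<Rightarrow>\<^sub>L 'y) \<Rightarrow> 'y set \<Rightarrow>
     real \<Rightarrow> real \<Rightarrow> real \<Rightarrow> nat \<Rightarrow> (nat \<Rightarrow> real) \<Rightarrow>
     'a \<Rightarrow> (nat \<Rightarrow> 'y \<Rightarrow> 'y) \<Rightarrow> bool" where
  "simultaneous_power_factorization scB scY e M \<iota> \<sigma> T \<epsilon> \<delta> r n\<^sub>0 \<alpha> a x \<longleftrightarrow>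
     (\<forall>n\<ge>1. \<forall>s\<in>T. s = \<sigma> (\<iota> a ^ n) (x n s))
   \<and> norm a \<le> M
   \<and> (\<forall>n\<ge>1. uniformly_continuous_on T (x n)
        \<and> homeomorphism T (x n ` T) (x n) (\<sigma> (\<iota> a ^ n)))
   \<and> (\<forall>n. 1 \<le> n \<and> n \<le> n\<^sub>0 \<longrightarrow> (\<forall>s\<in>T. norm (s - x n s) \<le> \<epsilon>))
   \<and> (\<forall>n\<ge>1. \<forall>s\<in>T. norm (x n s) \<le> \<alpha> n ^ n * max (norm s) \<delta>)
   \<and> (\<forall>s\<^sub>1 s\<^sub>2. s\<^sub>1 \<in> T \<and> s\<^sub>2 \<in> T \<and> s\<^sub>1 + s\<^sub>2 \<in> T \<longrightarrow>
        (\<forall>n\<ge>1. x n (s\<^sub>1 + s\<^sub>2) = x n s\<^sub>1 + x n s\<^sub>2))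
   \<and> (\<forall>\<mu> s. s \<in> T \<and> scY \<mu> s \<in> T \<longrightarrow> (\<forall>n\<ge>1. x n (scY \<mu> s) = scY \<mu> (x n s)))
   \<and> (\<exists>(u :: nat \<Rightarrow> 'a) (l :: nat \<Rightarrow> 'l) (b :: nat \<Rightarrow> 'b) (bi :: nat \<Rightarrow> 'b).
        (\<lambda>i. (r * (1 - r) ^ i) *\<^sub>R u (Suc i)) sums a
      \<and> a \<in> closure (convex hull (u ` {1..}))
      \<and> (\<forall>k. b k = (1 - r) ^ k *\<^sub>R 1 + (\<Sum>i=1..k. (r * (1 - r) ^ (i - 1)) *\<^sub>R \<iota> (u i)))
      \<and> (\<forall>k. b k \<in> convex hull (insert 1 ((\<lambda>i. \<iota> (u i)) ` {1..k})))
      \<and> (\<forall>k. b k * bi k = 1 \<and> bi k * b k = 1)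
      \<and> (\<forall>k. bi k \<in> generated_unital_subalgebra scB ((\<lambda>i. \<iota> (u i)) ` {1..k}))
      \<and> (\<forall>n\<ge>1. \<forall>s\<in>T. (\<lambda>k. \<sigma> (bi k ^ n) s) \<longlonglongrightarrow> x n s)
      \<and> (\<forall>k\<ge>1. u k = e (l k))
      \<and> (\<forall>k\<ge>1. l k \<le> l (Suc k))
      \<and> ((\<nexists>m :: 'l. \<forall>j. j \<le> m) \<longrightarrow> (\<forall>k\<ge>1. l k < l (Suc k))))
   \<and> (bounded T \<longrightarrow> (\<forall>n\<ge>1. bounded (x n ` T)))
   \<and> (totally_bounded T \<longrightarrow> (\<forall>n\<ge>1. totally_bounded (x n ` T)))
   \<and> (\<forall>n\<ge>1. uniform_limit T (\<lambda>j s. \<sigma> (\<iota> (e j)) (x n s)) (x n) tails)"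

end

theory Submission
  imports Defs
begin

text \<open>
  The limit \<open>a = \<Sum> r (1 - r)\<^sup>i u\<^sub>i\<^sub>+\<^sub>1\<close> lies in \<open>A\<close>, but its partial sums completed by a multiple of the
  unit, the \<open>b\<^sub>k\<close>, can be kept invertible by choosing \<open>u\<^sub>k\<^sub>+\<^sub>1\<close> far enough along the approximate
  identity. The inverses grow at most like \<open>\<kappa>\<^sup>k\<close>, with \<open>\<kappa>\<close> independent of the choices. As \<open>u\<^sub>k\<^sub>+\<^sub>1\<close>
  nearly fixes \<open>\<sigma> (b\<^sub>k\<^sup>-\<^sup>m) s\<close>, uniformly in \<open>s\<close>, the step from \<open>b\<^sub>k\<^sup>-\<^sup>n s\<close> to \<open>b\<^sub>k\<^sub>+\<^sub>1\<^sup>-\<^sup>n s\<close> is as small as one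
  likes for finitely many \<open>n\<close> at a time. Because \<open>\<alpha>\<^sub>n \<rightarrow> \<infinity>\<close>, at step \<open>k\<close> all but finitely many \<open>n\<close>
  can be left uncontrolled: \<open>\<alpha>\<^sub>n\<close> already dominates \<open>\<kappa>\<^sup>k\<^sup>+\<^sup>1\<close> for these, which gives the growth bound.
  For nets, all hypotheses pass from \<open>S\<close> to \<open>S'\<close> because the norm is a supremum.
\<close>

section \<open>Inverses in closed unital subalgebras\<close>

text \<open>Only real scalars are demanded. A closed unital subalgebra over the field is in
  particular one of these, so an element of every such set containing given generators lies in their
  \<open>generated_unital_subalgebra\<close>.\<close>

definition closed_unital_subalgebra :: "'b::real_normed_algebra_1 set \<Rightarrow> bool" where
  "closed_unital_subalgebra A \<longleftrightarrow>
     1 \<in> A \<and> subspace A \<and> (\<forall>b\<in>A. \<forall>c\<in>A. b * c \<in> A) \<and> closed A"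

lemma closed_unital_subalgebraD:
  assumes "closed_unital_subalgebra A"
  shows "1 \<in> A"
    and "b \<in> A \<Longrightarrow> c \<in> A \<Longrightarrow> b + c \<in> A"
    and "b \<in> A \<Longrightarrow> c \<in> A \<Longrightarrow> b - c \<in> A"
    and "b \<in> A \<Longrightarrow> t *\<^sub>R b \<in> A"
    and "b \<in> A \<Longrightarrow> c \<in> A \<Longrightarrow> b * c \<in> A"
  using assms by (auto simp: closed_unital_subalgebra_def intro: subspace_add subspace_diff subspace_scale)

text \<open>The Neumann series in 1 - y. Its partial sums are polynomials in y, whence the last
  clause, which later carries the inverses into the generated subalgebra.\<close>

lemma neumann_inverse:
  fixes y :: "'b::{real_normed_algebra_1, banach}"
  assumes y: "norm (1 - y) \<le> t" and t: "t < 1"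
  obtains z where "y * z = 1" "z * y = 1" "norm z \<le> 1 / (1 - t)"
    "\<And>A. closed_unital_subalgebra A \<Longrightarrow> y \<in> A \<Longrightarrow> z \<in> A"
proof
  let ?x = "1 - y" and ?z = "\<Sum>n. (1 - y) ^ n"
  have t0: "0 \<le> t" using y norm_ge_zero order_trans by blast
  have le: "norm (?x ^ n) \<le> t ^ n" for n
    by (rule order_trans[OF norm_power_ineq power_mono[OF y]]) simp
  have st: "summable (\<lambda>n. t ^ n)" using t t0 by (simp add: summable_geometric)
  have summable: "summable (\<lambda>n. ?x ^ n)"
    by (rule summable_comparison_test[OF _ st]) (use le in auto)
  then have sums: "(\<lambda>n. \<Sum>i<n. ?x ^ i) \<longlonglongrightarrow> ?z" by (rule summable_LIMSEQ)
  have "(\<lambda>n. ?x ^ n) \<longlonglongrightarrow> 0" by (rule summable_LIMSEQ_zero[OF summable])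
  then have lim1: "(\<lambda>n. 1 - ?x ^ n) \<longlonglongrightarrow> 1" using tendsto_diff[OF tendsto_const[of 1]] by force
  have "y * (\<Sum>i<n. ?x ^ i) = 1 - ?x ^ n" for n
    by (induction n) (auto simp: algebra_simps)
  moreover have "(\<Sum>i<n. x ^ i) * (1 - x) = 1 - x ^ n" for n and x :: 'b
  proof (induction n)
    case (Suc n)
    have "(\<Sum>i<Suc n. x ^ i) * (1 - x) = (\<Sum>i<n. x ^ i) * (1 - x) + (x ^ n - x ^ n * x)"
      by (simp add: distrib_right right_diff_distrib)
    also have "\<dots> = 1 - x ^ Suc n" by (simp only: Suc.IH power_Suc2) simp
    finally show ?case .
  qed simp
  from this[of ?x] have "(\<Sum>i<n. ?x ^ i) * y = 1 - ?x ^ n" for n by simp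
  ultimately have "(\<lambda>n. 1 - ?x ^ n) \<longlonglongrightarrow> y * ?z" "(\<lambda>n. 1 - ?x ^ n) \<longlonglongrightarrow> ?z * y"
    using tendsto_mult[OF tendsto_const[of y] sums] tendsto_mult[OF sums tendsto_const[of y]]
    by (simp_all only:)
  with lim1 show "y * ?z = 1" "?z * y = 1" using LIMSEQ_unique by blast+
  have sn: "summable (\<lambda>n. norm (?x ^ n))"
    by (rule summable_comparison_test[OF _ st]) (use le in auto)
  have "norm ?z \<le> (\<Sum>n. norm (?x ^ n))" by (rule summable_norm[OF sn])
  also have "\<dots> \<le> (\<Sum>n. t ^ n)" by (rule suminf_le[OF le sn st])
  also have "\<dots> = 1 / (1 - t)" using t t0 by (simp add: suminf_geometric)
  finally show "norm ?z \<le> 1 / (1 - t)" .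
  show "?z \<in> A" if A: "closed_unital_subalgebra A" and "y \<in> A" for A
  proof (rule closed_sequentially[OF _ _ sums])
    show "closed A" using A by (simp add: closed_unital_subalgebra_def)
    have "?x ^ i \<in> A" for i
      by (induction i) (use A that in \<open>auto intro: closed_unital_subalgebraD\<close>)
    then show "(\<Sum>i<n. ?x ^ i) \<in> A" for n
      using A by (intro subspace_sum) (auto simp: closed_unital_subalgebra_def)
  qed
qed


section \<open>The iteration step\<close>

text \<open>The estimates use real scalars only. \<open>C\<close> is taken at least 1 so that
  \<open>C \<le> C ^ n\<close> for n \<ge> 1, which lets it be absorbed into n-th powers.
  \<open>T\<close> is an arbitrary set of vectors; the sets of nets in \<open>S\<close> are
  substituted for it at the end.\<close>

locale cohen_iteration =
  fixes e :: "'l::directed_preorder \<Rightarrow> 'a::{real_normed_algebra, banach}"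
    and M r :: real
    and \<iota> :: "'a \<Rightarrow> 'b::{real_normed_algebra_1, banach}"
    and \<sigma> :: "'b \<Rightarrow> 'y::banach \<Rightarrow>\<^sub>L 'y"
    and T :: "'y set"
    and C :: real
  assumes M: "1 \<le> M" and r: "0 < r" and rM: "r * (M + 1) < 1"
    and norm_e: "norm (e l) \<le> M" and tendsto_e: "((\<lambda>l. e l * a) \<longlongrightarrow> a) tails"
    and linear_\<iota>: "bounded_linear \<iota>" and \<iota>_mult: "\<iota> (a * a') = \<iota> a * \<iota> a'"
    and norm_\<iota>: "norm (\<iota> a) = norm a"
    and linear_\<sigma>: "bounded_linear \<sigma>" and \<sigma>_mult: "\<sigma> (b * c) = \<sigma> b o\<^sub>L \<sigma> c"
    and \<sigma>_1: "\<sigma> 1 = id_blinfun"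
    and C: "1 \<le> C" and norm_\<sigma>: "norm (\<sigma> b) \<le> C * norm b"
    and uniform_T: "uniform_limit T (\<lambda>l s. \<sigma> (\<iota> (e l)) s) (\<lambda>s. s) tails"
    and bounded_or_commutative: "bounded T \<or> (\<forall>l m. e l * e m = e m * e l)"
begin

lemmas \<iota>_simps = bounded_linear.linear[OF linear_\<iota>, THEN linear_add]
  bounded_linear.linear[OF linear_\<iota>, THEN linear_diff]
  bounded_linear.linear[OF linear_\<iota>, THEN linear_scale]
  bounded_linear.linear[OF linear_\<iota>, THEN linear_0]

lemmas \<sigma>_simps = bounded_linear.linear[OF linear_\<sigma>, THEN linear_add]
  bounded_linear.linear[OF linear_\<sigma>, THEN linear_diff]
  bounded_linear.linear[OF linear_\<sigma>, THEN linear_scale]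

lemma norm_\<sigma>_apply: "norm (\<sigma> b s) \<le> C * norm b * norm s"
  by (rule order_trans[OF norm_blinfun mult_right_mono[OF norm_\<sigma>]]) simp

lemma r_less_1: "r < 1"
proof -
  have "r * 1 \<le> r * (M + 1)" using M r by (intro mult_left_mono) auto
  then show ?thesis using rM by simp
qed

text \<open>For \<open>b = 1\<close> this is the assumption on \<open>T\<close>. It is needed for
  the powers of the successive inverses, since the next index has to serve every \<open>s\<close> at
  once.\<close>

definition fixed_in_limit :: "'b \<Rightarrow> bool" where
  "fixed_in_limit b \<longleftrightarrow> uniform_limit T (\<lambda>l s. \<sigma> (\<iota> (e l)) (\<sigma> b s)) (\<lambda>s. \<sigma> b s) tails"

text \<open>Commutation moves \<open>\<sigma> (\<iota> (e l))\<close> next to \<open>s\<close>; the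
  bounded operator \<open>\<sigma> b\<close> then preserves uniform convergence, also when
  \<open>T\<close> is unbounded.\<close>

lemma fixed_in_limit_commuting:
  assumes "\<And>l. \<iota> (e l) * b = b * \<iota> (e l)"
  shows "fixed_in_limit b"
proof -
  have "\<sigma> (\<iota> (e l)) (\<sigma> b s) = \<sigma> b (\<sigma> (\<iota> (e l)) s)" for l s
    using assms[of l] by (simp flip: \<sigma>_mult blinfun_apply_blinfun_compose)
  then show ?thesis
    using bounded_linear.uniform_limit[OF blinfun.bounded_linear_right uniform_T, of "\<sigma> b"]
    by (simp add: fixed_in_limit_def)
qed

text \<open>Norm convergence of \<open>\<iota> (e l) * d\<close> becomes uniform on \<open>T\<close>
  through the bound on \<open>norm s\<close>; the scalar part is covered by the assumption on
  \<open>T\<close>.\<close>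

lemma fixed_in_limit_bounded:
  assumes T: "bounded T" and d: "((\<lambda>l. \<iota> (e l) * d) \<longlongrightarrow> d) tails"
  shows "fixed_in_limit (d + t *\<^sub>R 1)"
proof -
  obtain K where K: "0 < K" "\<And>s. s \<in> T \<Longrightarrow> norm s \<le> K"
    using T by (auto simp: bounded_pos)
  have "uniform_limit T (\<lambda>l s. \<sigma> (\<iota> (e l) * d) s) (\<lambda>s. \<sigma> d s) tails"
  proof (rule uniform_limitI)
    fix \<eta> :: real assume "0 < \<eta>"
    then have "0 < \<eta> / (C * K)" using K C by simp
    from tendstoD[OF d this]
    show "\<forall>\<^sub>F l in tails. \<forall>s\<in>T. dist (\<sigma> (\<iota> (e l) * d) s) (\<sigma> d s) < \<eta>"
    proof eventually_elim
      case (elim l)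
      show ?case
      proof
        fix s assume s: "s \<in> T"
        have "dist (\<sigma> (\<iota> (e l) * d) s) (\<sigma> d s) = norm (\<sigma> (\<iota> (e l) * d - d) s)"
          by (simp add: dist_norm \<sigma>_simps blinfun.diff_left)
        also have "\<dots> \<le> C * norm (\<iota> (e l) * d - d) * K"
          by (rule order_trans[OF norm_\<sigma>_apply]) (use C K s in \<open>auto intro!: mult_left_mono\<close>)
        also have "\<dots> < \<eta>"
          using elim C K by (simp add: dist_norm field_simps)
        finally show "dist (\<sigma> (\<iota> (e l) * d) s) (\<sigma> d s) < \<eta>" .
      qed
    qed
  qed
  moreover have "uniform_limit T (\<lambda>l s. t *\<^sub>R \<sigma> (\<iota> (e l)) s) (\<lambda>s. t *\<^sub>R s) tails"
    by (rule bounded_linear.uniform_limit[OF bounded_linear_scaleR_right uniform_T])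
  ultimately have "uniform_limit T (\<lambda>l s. \<sigma> (\<iota> (e l) * d) s + t *\<^sub>R \<sigma> (\<iota> (e l)) s)
      (\<lambda>s. \<sigma> d s + t *\<^sub>R s) tails"
    by (rule uniform_limit_add)
  then show ?thesis
    by (simp add: fixed_in_limit_def \<sigma>_simps \<sigma>_1 \<sigma>_mult blinfun.bilinear_simps)
qed

text \<open>For bounded \<open>T\<close>, the powers of the inverse are, modulo scalars, in the right ideal
  of the \<open>d\<close> with \<open>e\<^sub>\<lambda> d \<rightarrow> d\<close>.\<close>

lemma fixed_in_limit_inverse_power:
  assumes b: "(t *\<^sub>R 1 + \<iota> c) * bi = 1" "bi * (t *\<^sub>R 1 + \<iota> c) = 1" and t: "t \<noteq> 0"
    and c: "(\<forall>l m. e l * e m = e m * e l) \<Longrightarrow> (\<forall>l. e l * c = c * e l)"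
  shows "fixed_in_limit (bi ^ m)"
  using bounded_or_commutative
proof
  assume "\<forall>l m. e l * e m = e m * e l"
  then have *: "\<iota> (e l) * (t *\<^sub>R 1 + \<iota> c) = (t *\<^sub>R 1 + \<iota> c) * \<iota> (e l)" for l
    using c by (simp add: distrib_left distrib_right flip: \<iota>_mult)
  have bi: "bi * \<iota> (e l) = \<iota> (e l) * bi" for l
  proof -
    have "bi * \<iota> (e l) = bi * (\<iota> (e l) * (t *\<^sub>R 1 + \<iota> c)) * bi"
      by (simp only: mult.assoc b mult_1_right)
    also have "\<dots> = (bi * (t *\<^sub>R 1 + \<iota> c)) * \<iota> (e l) * bi" by (simp only: * mult.assoc)
    finally show ?thesis by (simp only: b mult_1_left)
  qed
  then have "\<iota> (e l) * bi ^ m = bi ^ m * \<iota> (e l)" for l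
    by (simp add: power_commuting_commutes)
  then show ?thesis by (rule fixed_in_limit_commuting)
next
  assume T: "bounded T"
  define J where "J = {d. ((\<lambda>l. \<iota> (e l) * d) \<longlongrightarrow> d) tails}"
  have \<iota>c: "\<iota> c \<in> J"
    using bounded_linear.tendsto[OF linear_\<iota> tendsto_e[of c]] by (simp add: J_def \<iota>_mult)
  have mult: "d * x \<in> J" if "d \<in> J" for d x
    using tendsto_mult[of "\<lambda>l. \<iota> (e l) * d" d tails "\<lambda>_. x" x] that
    by (simp add: J_def mult.assoc)
  have add: "d + d' \<in> J" if "d \<in> J" "d' \<in> J" for d d'
    using that tendsto_add[of "\<lambda>l. \<iota> (e l) * d" d tails "\<lambda>l. \<iota> (e l) * d'" d']
    by (simp add: J_def distrib_left)
  have scale: "k *\<^sub>R d \<in> J" if "d \<in> J" for d k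
    using that tendsto_scaleR[OF tendsto_const[of k], of "\<lambda>l. \<iota> (e l) * d" d] by (simp add: J_def)
  \<comment> \<open>Solving (t + c) bi = 1 for \<open>bi\<close> writes it as a scalar plus an
    element of the right ideal \<open>J\<close>, a form that products preserve.\<close>
  have "t *\<^sub>R bi + \<iota> c * bi = 1" using b(1) by (simp add: distrib_right)
  then have "inverse t *\<^sub>R (t *\<^sub>R bi + \<iota> c * bi) = inverse t *\<^sub>R 1" by simp
  then have bi: "bi = (- inverse t) *\<^sub>R (\<iota> c * bi) + inverse t *\<^sub>R 1"
    using t by (simp add: scaleR_add_right algebra_simps)
  define d\<^sub>1 where "d\<^sub>1 = (- inverse t) *\<^sub>R (\<iota> c * bi)"
  have d1: "d\<^sub>1 \<in> J" "bi = d\<^sub>1 + inverse t *\<^sub>R 1"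
    using scale[OF mult[OF \<iota>c]] bi by (auto simp only: d\<^sub>1_def)
  have "\<exists>d k. d \<in> J \<and> bi ^ m = d + k *\<^sub>R 1"
  proof (induction m)
    case 0
    have "(0::'b) \<in> J" by (simp add: J_def)
    then show ?case by (intro exI[of _ 0] exI[of _ 1]) simp
  next
    case (Suc m)
    then obtain d k where d: "d \<in> J" "bi ^ m = d + k *\<^sub>R 1" by blast
    have "bi ^ Suc m = d\<^sub>1 * bi ^ m + inverse t *\<^sub>R bi ^ m"
      by (subst power_Suc, subst d1(2)) (simp add: distrib_right)
    also have "\<dots> = (d\<^sub>1 * bi ^ m + inverse t *\<^sub>R d) + (inverse t * k) *\<^sub>R 1"
      by (simp add: d(2) scaleR_add_right)
    finally show ?case using add[OF mult[OF d1(1)] scale[OF d(1)]] by blast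
  qed
  then show ?thesis using fixed_in_limit_bounded[OF T] by (auto simp: J_def)
qed

text \<open>The factor \<open>1 / (1 - r * (M + 1))\<close> bounds the Neumann inverse of 1 - r + r
  u for \<open>norm u \<le> M\<close>; the 2 bounds the inverse from the second Neumann series in
  \<open>inverse_step\<close>.\<close>

definition \<kappa> :: real where "\<kappa> = 2 / (1 - r * (M + 1))"

lemma \<kappa>_ge_2: "2 \<le> \<kappa>"
proof -
  have "0 \<le> r * (M + 1)" using r M by simp
  then show ?thesis using rM by (simp add: \<kappa>_def field_simps)
qed

text \<open>With \<open>f = 1 - r + r u\<close>, \<open>u = e\<^sub>\<lambda>\<close>, the new element is \<open>f g\<close> for \<open>g = t + f\<^sup>-\<^sup>1 c\<close>, and \<open>g\<close> is
  close to the old element \<open>t + c\<close> because \<open>f\<^sup>-\<^sup>1 c - c = r f\<^sup>-\<^sup>1 (c - u c)\<close>.\<close>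

lemma inverse_step:
  assumes b: "(t *\<^sub>R 1 + \<iota> c) * bi = 1" "bi * (t *\<^sub>R 1 + \<iota> c) = 1"
    and close: "norm bi * \<kappa> * norm (\<iota> (e l) * \<iota> c - \<iota> c) \<le> 1"
  obtains bi' where "(((1 - r) * t) *\<^sub>R 1 + \<iota> (c + (r * t) *\<^sub>R e l)) * bi' = 1"
    "bi' * (((1 - r) * t) *\<^sub>R 1 + \<iota> (c + (r * t) *\<^sub>R e l)) = 1"
    "norm bi' \<le> \<kappa> * norm bi"
    "\<And>A. closed_unital_subalgebra A \<Longrightarrow> \<iota> c \<in> A \<Longrightarrow> \<iota> (e l) \<in> A \<Longrightarrow> bi \<in> A \<Longrightarrow> bi' \<in> A"
proof -
  define f where "f = (1 - r) *\<^sub>R 1 + r *\<^sub>R \<iota> (e l)"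
  \<comment> \<open>The restriction on \<open>r\<close> enters here: 1 - f = r (1 - u) has norm at
    most \<open>r * (M + 1)\<close>, which is below 1.\<close>
  have "norm (1 - f) = norm (r *\<^sub>R (1 - \<iota> (e l)))"
    by (simp add: f_def scaleR_diff_right scaleR_diff_left)
  also have "\<dots> \<le> r * (M + 1)"
    using r norm_triangle_ineq4[of 1 "\<iota> (e l)"] norm_e[of l]
    by (auto simp: norm_\<iota> intro!: mult_left_mono)
  finally have "norm (1 - f) \<le> r * (M + 1)" .
  then obtain fi where fi: "f * fi = 1" "fi * f = 1" "norm fi \<le> 1 / (1 - r * (M + 1))"
    "\<And>A. closed_unital_subalgebra A \<Longrightarrow> f \<in> A \<Longrightarrow> fi \<in> A"
    using rM by (rule neumann_inverse) blast
  have "\<kappa> / 2 = 1 / (1 - r * (M + 1))" using rM by (simp only: \<kappa>_def) (simp add: divide_simps)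
  with fi(3) have "norm fi \<le> \<kappa> / 2" by (simp only:)
  note fi = fi(1,2) this fi(4)
  define g where "g = t *\<^sub>R 1 + fi * \<iota> c"
  have "fi * \<iota> c - \<iota> c = fi * \<iota> c - (fi * f) * \<iota> c" by (simp add: fi)
  also have "\<dots> = r *\<^sub>R (fi * (\<iota> c - \<iota> (e l) * \<iota> c))"
    by (simp add: f_def algebra_simps)
  finally have "norm (fi * \<iota> c - \<iota> c) \<le> r * (norm fi * norm (\<iota> c - \<iota> (e l) * \<iota> c))"
    using r by (simp add: norm_mult_ineq)
  also have "\<dots> \<le> 1 * (\<kappa> / 2 * norm (\<iota> c - \<iota> (e l) * \<iota> c))"
    using r r_less_1 fi \<kappa>_ge_2 by (intro mult_mono mult_nonneg_nonneg) auto
  finally have fc: "norm (fi * \<iota> c - \<iota> c) \<le> \<kappa> / 2 * norm (\<iota> (e l) * \<iota> c - \<iota> c)"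
    by (simp add: norm_minus_commute)
  \<comment> \<open>Since \<open>g\<close> is near t + c, which \<open>bi\<close> inverts,
    \<open>bi * g\<close> is within 1/2 of 1. With \<open>h\<close> its inverse,
    \<open>g * h\<close> is the old element t + c, so that \<open>h * bi\<close> inverts
    \<open>g\<close> and \<open>h * bi * fi\<close> inverts \<open>f * g\<close>.\<close>
  have "1 - bi * g = bi * (t *\<^sub>R 1 + \<iota> c) - bi * g" by (simp add: b)
  also have "\<dots> = - (bi * (fi * \<iota> c - \<iota> c))" by (simp add: g_def algebra_simps)
  finally have "norm (1 - bi * g) \<le> norm bi * norm (fi * \<iota> c - \<iota> c)"
    by (simp add: norm_mult_ineq)
  also have "\<dots> \<le> norm bi * (\<kappa> / 2 * norm (\<iota> (e l) * \<iota> c - \<iota> c))"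
    by (rule mult_left_mono[OF fc]) simp
  also have "\<dots> \<le> 1 / 2" using close by simp
  finally have "norm (1 - bi * g) \<le> 1 / 2" .
  from neumann_inverse[OF this] obtain h where h: "bi * g * h = 1" "h * (bi * g) = 1" "norm h \<le> 2"
    "\<And>A. closed_unital_subalgebra A \<Longrightarrow> bi * g \<in> A \<Longrightarrow> h \<in> A" by auto
  have "g * h = (t *\<^sub>R 1 + \<iota> c) * bi * g * h" by (simp add: b)
  also have "\<dots> = t *\<^sub>R 1 + \<iota> c" using h(1) by (metis mult.assoc mult.right_neutral)
  finally have gh: "g * h = t *\<^sub>R 1 + \<iota> c" .
  have b': "((1 - r) * t) *\<^sub>R 1 + \<iota> (c + (r * t) *\<^sub>R e l) = f * g"
  proof -
    have "f * g = t *\<^sub>R f + (f * fi) * \<iota> c" by (simp add: g_def distrib_left mult.assoc)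
    also have "\<dots> = ((1 - r) * t) *\<^sub>R 1 + \<iota> (c + (r * t) *\<^sub>R e l)"
      by (simp add: fi(1)) (simp add: f_def \<iota>_simps scaleR_add_right mult.commute)
    finally show ?thesis by simp
  qed
  show ?thesis
  proof
    have "f * g * (h * bi * fi) = f * ((g * h) * bi) * fi" by (simp add: mult.assoc)
    then show "(((1 - r) * t) *\<^sub>R 1 + \<iota> (c + (r * t) *\<^sub>R e l)) * (h * bi * fi) = 1"
      unfolding b' by (simp add: gh b fi)
    have "h * bi * fi * (f * g) = h * bi * (fi * f) * g" by (simp add: mult.assoc)
    then show "h * bi * fi * (((1 - r) * t) *\<^sub>R 1 + \<iota> (c + (r * t) *\<^sub>R e l)) = 1"
      unfolding b' using h by (simp add: fi mult.assoc)
    have "norm (h * bi * fi) \<le> norm h * norm bi * norm fi"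
      by (rule order_trans[OF norm_mult_ineq mult_right_mono[OF norm_mult_ineq]]) simp
    also have "\<dots> \<le> 2 * norm bi * (\<kappa> / 2)"
      using h fi \<kappa>_ge_2 by (intro mult_mono) auto
    finally show "norm (h * bi * fi) \<le> \<kappa> * norm bi" by (simp add: mult.commute)
    show "h * bi * fi \<in> A"
      if A: "closed_unital_subalgebra A" and mem: "\<iota> c \<in> A" "\<iota> (e l) \<in> A" "bi \<in> A" for A
    proof -
      note cl = closed_unital_subalgebraD[OF A]
      have "fi \<in> A" using mem by (intro fi A) (auto simp: f_def intro!: cl)
      moreover from this mem have "h \<in> A" by (intro h A) (auto simp: g_def intro!: cl)
      ultimately show ?thesis using mem by (intro cl)
    qed
  qed
qed

text \<open>Telescoping with \<open>bi' - bi = bi' (b - b') bi\<close> puts the factor \<open>1 - u\<close> directly in front of the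
  powers of the old inverse, which it nearly annihilates, uniformly on \<open>T\<close> even if \<open>T\<close> is unbounded.\<close>

lemma power_difference_bound:
  assumes bi: "(t *\<^sub>R 1 + \<iota> c) * bi = 1"
    and bi': "bi' * (((1 - r) * t) *\<^sub>R 1 + \<iota> (c + (r * t) *\<^sub>R e l)) = 1"
    and t: "0 \<le> t" "t \<le> 1" and q: "C * norm bi' \<le> q" "1 \<le> q" and "0 \<le> \<zeta>"
    and small: "\<And>m. m \<le> N \<Longrightarrow> norm (\<sigma> (\<iota> (e l)) (\<sigma> (bi ^ m) s) - \<sigma> (bi ^ m) s) \<le> \<zeta>"
    and "n \<le> N"
  shows "norm (\<sigma> (bi' ^ n) s - \<sigma> (bi ^ n) s) \<le> real n * q ^ n * \<zeta>"
  using \<open>n \<le> N\<close>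
proof (induction n)
  case (Suc n)
  let ?b = "t *\<^sub>R 1 + \<iota> c" and ?b' = "((1 - r) * t) *\<^sub>R 1 + \<iota> (c + (r * t) *\<^sub>R e l)"
  have "?b - ?b' = (r * t) *\<^sub>R (1 - \<iota> (e l))" by (simp add: \<iota>_simps algebra_simps)
  moreover have "bi' * (?b - ?b') * bi = bi' * (?b * bi) - (bi' * ?b') * bi"
    by (simp only: left_diff_distrib right_diff_distrib mult.assoc)
  then have "bi' - bi = bi' * (?b - ?b') * bi" by (simp only: bi bi' mult_1_left mult_1_right)
  ultimately have d: "bi' - bi = (r * t) *\<^sub>R (bi' * (1 - \<iota> (e l)) * bi)" by simp
  \<comment> \<open>As \<open>bi' - bi\<close> ends in a factor \<open>bi\<close>, the second term
    contains \<open>bi ^ Suc n\<close>; hence \<open>small\<close> is applied at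
    \<open>Suc n\<close>, still at most \<open>N\<close>.\<close>
  have "bi' ^ Suc n - bi ^ Suc n = bi' * (bi' ^ n - bi ^ n) + (bi' - bi) * bi ^ n"
    by (simp add: algebra_simps)
  also have "\<dots> = bi' * (bi' ^ n - bi ^ n) + (r * t) *\<^sub>R (bi' * ((1 - \<iota> (e l)) * bi ^ Suc n))"
    by (simp add: d mult.assoc)
  finally have "\<sigma> (bi' ^ Suc n) s - \<sigma> (bi ^ Suc n) s =
      \<sigma> bi' (\<sigma> (bi' ^ n) s - \<sigma> (bi ^ n) s)
      - (r * t) *\<^sub>R \<sigma> bi' (\<sigma> (\<iota> (e l)) (\<sigma> (bi ^ Suc n) s) - \<sigma> (bi ^ Suc n) s)"
    apply (subst blinfun.diff_left[symmetric], subst \<sigma>_simps(2)[symmetric])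
    apply (simp only: \<sigma>_simps \<sigma>_mult \<sigma>_1 blinfun.bilinear_simps blinfun_apply_blinfun_compose
        blinfun_apply_id_blinfun left_diff_distrib mult_1_left)
    apply (simp add: algebra_simps)
    done
  moreover have "norm (\<sigma> bi' (\<sigma> (bi' ^ n) s - \<sigma> (bi ^ n) s)) \<le> q * (real n * q ^ n * \<zeta>)"
    using Suc q by (intro order_trans[OF norm_\<sigma>_apply] mult_mono) auto
  moreover have "norm ((r * t) *\<^sub>R \<sigma> bi' (\<sigma> (\<iota> (e l)) (\<sigma> (bi ^ Suc n) s) - \<sigma> (bi ^ Suc n) s))
      \<le> 1 * (q * \<zeta>)"
  proof -
    have "r * t \<le> 1 * 1" using t r r_less_1 by (intro mult_mono) auto
    moreover have "norm (\<sigma> bi' (\<sigma> (\<iota> (e l)) (\<sigma> (bi ^ Suc n) s) - \<sigma> (bi ^ Suc n) s)) \<le> q * \<zeta>"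
      using q small[OF Suc.prems] by (intro order_trans[OF norm_\<sigma>_apply] mult_mono) auto
    ultimately show ?thesis
      unfolding norm_scaleR using t r by (intro mult_mono) auto
  qed
  ultimately have "norm (\<sigma> (bi' ^ Suc n) s - \<sigma> (bi ^ Suc n) s) \<le> q * (real n * q ^ n * \<zeta>) + q * \<zeta>"
    using norm_triangle_ineq4 order_trans add_mono by (smt (verit))
  moreover have "q * \<zeta> \<le> q * q ^ n * \<zeta>"
    using q \<open>0 \<le> \<zeta>\<close> one_le_power[of q n]
    by (intro mult_right_mono) (simp_all add: mult_le_cancel_left1)
  ultimately show ?case by (simp add: algebra_simps)
qed simp

text \<open>Both demands on l hold on a tail: \<open>e l * c\<close> is close enough to
  \<open>c\<close> for the inversion, and \<open>e l\<close> nearly fixes finitely many families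
  \<open>\<sigma> (bi ^ m) s\<close>. The eventual form leaves room to take the new index above the
  previous one.\<close>

lemma iteration_step:
  assumes b: "(t *\<^sub>R 1 + \<iota> c) * bi = 1" "bi * (t *\<^sub>R 1 + \<iota> c) = 1"
    and t: "0 < t" "t \<le> 1"
    and c: "(\<forall>l m. e l * e m = e m * e l) \<Longrightarrow> (\<forall>l. e l * c = c * e l)"
    and K: "norm bi \<le> K" "1 \<le> K" and \<eta>: "0 < \<eta>"
  shows "\<forall>\<^sub>F l in tails. \<exists>bi'. (((1 - r) * t) *\<^sub>R 1 + \<iota> (c + (r * t) *\<^sub>R e l)) * bi' = 1
    \<and> bi' * (((1 - r) * t) *\<^sub>R 1 + \<iota> (c + (r * t) *\<^sub>R e l)) = 1
    \<and> norm bi' \<le> \<kappa> * K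
    \<and> (\<forall>A. closed_unital_subalgebra A \<longrightarrow> \<iota> c \<in> A \<longrightarrow> \<iota> (e l) \<in> A \<longrightarrow> bi \<in> A \<longrightarrow> bi' \<in> A)
    \<and> (\<forall>n\<le>N. \<forall>s\<in>T. norm (\<sigma> (bi' ^ n) s - \<sigma> (bi ^ n) s) \<le> \<eta>)"
proof -
  \<comment> \<open>\<open>q\<close> bounds \<open>C * norm bi'\<close> before \<open>bi'\<close> is
    known, so that \<open>\<zeta>\<close> can be fixed before l. It is chosen to make
    \<open>real (Suc N) * q ^ N * \<zeta>\<close> equal to \<open>\<eta>\<close>;
    \<open>Suc N\<close> in place of \<open>N\<close> avoids division by 0.\<close>
  define q where "q = C * (\<kappa> * K)"
  have "1 * (1 * 1) \<le> C * (\<kappa> * K)" using C \<kappa>_ge_2 K by (intro mult_mono) auto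
  then have q: "1 \<le> q" by (simp add: q_def)
  define \<zeta> where "\<zeta> = \<eta> / (real (Suc N) * q ^ N)"
  have \<zeta>: "0 < \<zeta>" using q \<eta> by (simp add: \<zeta>_def)
  have "\<forall>\<^sub>F l in tails. \<forall>m\<in>{..N}. \<forall>s\<in>T. dist (\<sigma> (\<iota> (e l)) (\<sigma> (bi ^ m) s)) (\<sigma> (bi ^ m) s) < \<zeta>"
    using fixed_in_limit_inverse_power[OF b _ c] t \<zeta>
    by (intro eventually_ball_finite ballI uniform_limitD) (auto simp: fixed_in_limit_def)
  moreover have "\<forall>\<^sub>F l in tails. dist (e l * c) c < 1 / (K * \<kappa>)"
    using K \<kappa>_ge_2 by (intro tendstoD[OF tendsto_e]) auto
  ultimately show ?thesis
  proof eventually_elim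
    case (elim l)
    have "norm (\<iota> (e l) * \<iota> c - \<iota> c) = dist (e l * c) c"
      by (simp add: dist_norm flip: \<iota>_mult \<iota>_simps norm_\<iota>)
    then have "norm bi * \<kappa> * norm (\<iota> (e l) * \<iota> c - \<iota> c) \<le> K * \<kappa> * (1 / (K * \<kappa>))"
      using elim(2) K \<kappa>_ge_2 by (intro mult_mono) auto
    also have "\<dots> = 1" using K \<kappa>_ge_2 by simp
    finally obtain bi' where bi': "(((1 - r) * t) *\<^sub>R 1 + \<iota> (c + (r * t) *\<^sub>R e l)) * bi' = 1"
      "bi' * (((1 - r) * t) *\<^sub>R 1 + \<iota> (c + (r * t) *\<^sub>R e l)) = 1"
      "norm bi' \<le> \<kappa> * norm bi"
      "\<And>A. closed_unital_subalgebra A \<Longrightarrow> \<iota> c \<in> A \<Longrightarrow> \<iota> (e l) \<in> A \<Longrightarrow> bi \<in> A \<Longrightarrow> bi' \<in> A"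
      using inverse_step[OF b] by blast
    have "\<kappa> * norm bi \<le> \<kappa> * K" using K \<kappa>_ge_2 by (intro mult_left_mono) auto
    then have norm_bi': "norm bi' \<le> \<kappa> * K" using bi' by simp
    have Cq: "C * norm bi' \<le> q" unfolding q_def using norm_bi' C by (intro mult_left_mono) auto
    have "norm (\<sigma> (bi' ^ n) s - \<sigma> (bi ^ n) s) \<le> \<eta>" if n: "n \<le> N" and s: "s \<in> T" for n s
    proof -
      have "norm (\<sigma> (bi' ^ n) s - \<sigma> (bi ^ n) s) \<le> real n * q ^ n * \<zeta>"
        by (rule power_difference_bound[OF b(1) bi'(2) _ _ Cq q _ _ n])
          (use t \<zeta> elim(1) s in \<open>auto simp: dist_norm intro: less_imp_le\<close>)
      also have "\<dots> \<le> real (Suc N) * q ^ N * \<zeta>"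
        using n q \<zeta> by (intro mult_right_mono mult_mono power_increasing) auto
      also have "\<dots> = \<eta>" using q by (simp add: \<zeta>_def)
      finally show ?thesis .
    qed
    then show ?case using bi' norm_bi' by blast
  qed
qed

end

section \<open>Uniform limits\<close>

text \<open>Control is assumed only from index \<open>k\<close> on, since a given exponent is
  treated only from some step on. The total error after \<open>k\<close> is a geometric
  tail.\<close>

lemma uniform_limit_geometric_increments:
  fixes F :: "nat \<Rightarrow> 'c \<Rightarrow> 'y::banach"
  assumes F: "\<And>j s. k \<le> j \<Longrightarrow> s \<in> T \<Longrightarrow> norm (F (Suc j) s - F j s) \<le> \<eta> / 2 ^ Suc j"
    and \<eta>: "0 \<le> \<eta>"
  shows "uniform_limit T F (\<lambda>s. lim (\<lambda>j. F j s)) sequentially"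
    and "s \<in> T \<Longrightarrow> norm (lim (\<lambda>j. F j s) - F k s) \<le> \<eta>"
proof -
  \<comment> \<open>The subtracted term is what the finite geometric sum leaves out; with it the
    induction on \<open>d\<close> closes.\<close>
  have *: "norm (F (i + d) s - F i s) \<le> \<eta> / 2 ^ i - \<eta> / 2 ^ (i + d)" if "k \<le> i" "s \<in> T" for i d s
  proof (induction d)
    case (Suc d)
    have "norm (F (i + Suc d) s - F i s)
        \<le> norm (F (Suc (i + d)) s - F (i + d) s) + norm (F (i + d) s - F i s)"
      using norm_triangle_ineq[of "F (Suc (i + d)) s - F (i + d) s" "F (i + d) s - F i s"] by simp
    also have "\<dots> \<le> \<eta> / 2 ^ Suc (i + d) + (\<eta> / 2 ^ i - \<eta> / 2 ^ (i + d))"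
      using that Suc by (intro add_mono F) auto
    also have "\<dots> = \<eta> / 2 ^ i - \<eta> / 2 ^ (i + Suc d)" by simp
    finally show ?case .
  qed simp
  have le: "norm (F j s - F i s) \<le> \<eta> / 2 ^ i" if "k \<le> i" "i \<le> j" "s \<in> T" for i j s
  proof -
    have "\<eta> / 2 ^ i - \<eta> / 2 ^ (i + (j - i)) \<le> \<eta> / 2 ^ i" using \<eta> by simp
    then show ?thesis using *[of i s "j - i"] that by simp
  qed
  have small: "\<exists>i\<ge>k. \<eta> / 2 ^ i < d" if "0 < d" for d
  proof -
    have "(\<lambda>i. \<eta> * (1 / 2) ^ i) \<longlonglongrightarrow> \<eta> * 0"
      by (intro tendsto_intros LIMSEQ_realpow_zero) auto
    then have "(\<lambda>i. \<eta> / 2 ^ i) \<longlonglongrightarrow> 0" by (simp add: power_divide)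
    then have "\<forall>\<^sub>F i in sequentially. \<eta> / 2 ^ i < d" using that by (rule order_tendstoD(2))
    then obtain i where "\<And>j. i \<le> j \<Longrightarrow> \<eta> / 2 ^ j < d" by (auto simp: eventually_sequentially)
    then show ?thesis by (intro exI[of _ "max i k"]) simp
  qed
  have lim: "(\<lambda>j. F j s) \<longlonglongrightarrow> lim (\<lambda>j. F j s)" if s: "s \<in> T" for s
  proof -
    have "Cauchy (\<lambda>j. F j s)"
    proof (rule metric_CauchyI)
      fix d :: real assume "0 < d"
      then obtain i where i: "k \<le> i" "\<eta> / 2 ^ i < d / 2" using small[of "d / 2"] by auto
      have "dist (F m s) (F n s) < d" if "i \<le> m" "i \<le> n" for m n
        using le[OF i(1) that(1) s] le[OF i(1) that(2) s] i(2)
          dist_triangle2[of "F m s" "F n s" "F i s"] unfolding dist_norm by linarith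
      then show "\<exists>M. \<forall>m\<ge>M. \<forall>n\<ge>M. dist (F m s) (F n s) < d" by blast
    qed
    then show ?thesis by (simp add: Cauchy_convergent_iff convergent_LIMSEQ_iff)
  qed
  have bound: "norm (lim (\<lambda>j. F j s) - F i s) \<le> \<eta> / 2 ^ i" if "k \<le> i" "s \<in> T" for i s
    using that le
    by (intro tendsto_upperbound[OF tendsto_norm[OF tendsto_diff[OF lim tendsto_const]]])
      (auto simp: eventually_sequentially)
  show "uniform_limit T F (\<lambda>s. lim (\<lambda>j. F j s)) sequentially"
  proof (rule uniform_limitI)
    fix d :: real assume "0 < d"
    then obtain i where i: "k \<le> i" "\<eta> / 2 ^ i < d" using small by blast
    have "dist (F n s) (lim (\<lambda>j. F j s)) < d" if "i \<le> n" "s \<in> T" for n s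
    proof -
      have "\<eta> / 2 ^ n \<le> \<eta> / 2 ^ i" using \<eta> that by (intro divide_left_mono power_increasing) auto
      then show ?thesis
        using bound[of n s] that i by (simp add: dist_norm norm_minus_commute)
    qed
    then show "\<forall>\<^sub>F n in sequentially. \<forall>s\<in>T. dist (F n s) (lim (\<lambda>j. F j s)) < d"
      by (auto simp: eventually_sequentially)
  qed
  show "norm (lim (\<lambda>j. F j s) - F k s) \<le> \<eta>" if "s \<in> T"
  proof -
    have "\<eta> / 2 ^ k \<le> \<eta> / 1" using \<eta> by (intro divide_left_mono) auto
    then show ?thesis using bound[of k s] that by simp
  qed
qed

lemma uniform_limit_uniformly_continuous_on:
  fixes F :: "nat \<Rightarrow> 'c::metric_space \<Rightarrow> 'd::metric_space"
  assumes lim: "uniform_limit T F f sequentially" and F: "\<And>n. uniformly_continuous_on T (F n)"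
  shows "uniformly_continuous_on T f"
  unfolding uniformly_continuous_on_def
proof (intro allI impI)
  fix d :: real assume "0 < d"
  then obtain n where n: "\<And>s. s \<in> T \<Longrightarrow> dist (F n s) (f s) < d / 3"
    using uniform_limitD[OF lim, of "d / 3"] by (auto simp: eventually_sequentially)
  obtain h where "0 < h" and h: "\<And>s s'. s \<in> T \<Longrightarrow> s' \<in> T \<Longrightarrow> dist s' s < h \<Longrightarrow> dist (F n s') (F n s) < d / 3"
    using F[of n, unfolded uniformly_continuous_on_def, rule_format, of "d / 3"] \<open>0 < d\<close> by auto
  have "dist (f s') (f s) < d" if "s \<in> T" "s' \<in> T" "dist s' s < h" for s s'
    using n[of s] n[of s'] h[OF that] that(1,2)
      dist_triangle[of "f s'" "f s" "F n s'"] dist_triangle[of "F n s'" "f s" "F n s"]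
    by (simp add: dist_commute)
  then show "\<exists>h>0. \<forall>s\<in>T. \<forall>s'\<in>T. dist s' s < h \<longrightarrow> dist (f s') (f s) < d" using \<open>0 < h\<close> by blast
qed

lemma totally_bounded_uniformly_continuous_image:
  fixes f :: "'c::metric_space \<Rightarrow> 'd::metric_space"
  assumes f: "uniformly_continuous_on T f" and T: "totally_bounded T"
  shows "totally_bounded (f ` T)"
  unfolding totally_bounded_metric
proof (intro allI impI)
  fix d :: real assume "0 < d"
  then obtain h where "0 < h"
    and h: "\<And>s s'. s \<in> T \<Longrightarrow> s' \<in> T \<Longrightarrow> dist s' s < h \<Longrightarrow> dist (f s') (f s) < d"
    using f unfolding uniformly_continuous_on_def by metis
  obtain X where X: "finite X" "T \<subseteq> (\<Union>x\<in>X. {y. dist x y < h / 2})"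
    using T \<open>0 < h\<close> unfolding totally_bounded_metric by (meson half_gt_zero)
  \<comment> \<open>The centres in \<open>X\<close> may lie outside \<open>T\<close>, where
    \<open>f\<close> is not controlled. Each is replaced by a point of \<open>T\<close> within
    \<open>h / 2\<close>, and the two halves add up to \<open>h\<close>. Where there is no such
    point, the choice is arbitrary and the centre covers no point of \<open>T\<close>.\<close>
  define p where "p x = (SOME y. y \<in> T \<and> dist x y < h / 2)" for x
  have "f s \<in> (\<Union>z\<in>(\<lambda>x. f (p x)) ` X. {y. dist z y < d})" if s: "s \<in> T" for s
  proof -
    obtain x where x: "x \<in> X" "dist x s < h / 2" using X s by blast
    then have p: "p x \<in> T \<and> dist x (p x) < h / 2"
      unfolding p_def using s by (intro someI[of "\<lambda>y. y \<in> T \<and> dist x y < h / 2" s]) simp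
    then have "dist (p x) s < h" using x dist_triangle[of "p x" s x] by (simp add: dist_commute)
    then show ?thesis using h[of s "p x"] s p x by blast
  qed
  then show "\<exists>Z. finite Z \<and> f ` T \<subseteq> (\<Union>z\<in>Z. {y. dist z y < d})"
    using X(1) by (intro exI[of _ "(\<lambda>x. f (p x)) ` X"]) blast
qed


section \<open>The factorization\<close>

text \<open>Without a largest element, some j fails \<open>j \<le> l\<close>. Anything above both j
  and l is then strictly above l, as strictness in a preorder only asks that the reverse comparison
  fail.\<close>

lemma eventually_tails_above:
  fixes l :: "'l::directed_preorder"
  assumes "\<forall>\<^sub>F l in tails. P l"
  obtains l' where "P l'" "l \<le> l'" "(\<nexists>m :: 'l. \<forall>j. j \<le> m) \<longrightarrow> l < l'"
proof -
  obtain k where k: "\<And>i. k \<le> i \<Longrightarrow> P i" using assms by (auto simp: eventually_tails)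
  obtain j :: 'l where j: "(\<nexists>m :: 'l. \<forall>j. j \<le> m) \<longrightarrow> \<not> j \<le> l" by blast
  obtain i where i: "k \<le> i" "l \<le> i" using directed by blast
  obtain l' where l': "i \<le> l'" "j \<le> l'" using directed by blast
  show ?thesis
    using that[of l'] k i l' j by (meson order_trans less_le_not_le)
qed

text \<open>Absorbs the additive error of the growth bound into an n-th power, with
  \<open>y = C * \<kappa> ^ k\<close>.\<close>

lemma power_plus_one_le:
  fixes y :: real
  assumes "0 \<le> y" "1 \<le> n"
  shows "y ^ n + 1 \<le> (y + 1) ^ n"
  using assms(2)
proof (induction n rule: nat_induct_at_least)
  case (Suc n)
  have "y ^ Suc n + 1 \<le> (y + 1) * (y ^ n + 1)" using assms(1) by (simp add: algebra_simps)
  also have "\<dots> \<le> (y + 1) * (y + 1) ^ n" using assms(1) Suc.IH by (intro mult_left_mono) auto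
  finally show ?case by simp
qed simp

lemma normed_scaling_subspace:
  assumes "normed_scaling sc" "module.subspace sc A"
  shows "subspace A"
proof -
  interpret vector_space sc using assms by (simp add: normed_scaling_def)
  have "t *\<^sub>R v = sc (of_real t) v" for t v using assms by (simp add: normed_scaling_def)
  then show ?thesis
    using assms(2) by (auto simp: Real_Vector_Spaces.subspace_def subspace_def)
qed

lemma geometric_weights_sum:
  fixes r :: real
  shows "(\<Sum>i<k. r * (1 - r) ^ i) = 1 - (1 - r) ^ k"
  by (induction k) (auto simp: algebra_simps)

lemma geometric_series_closure_convex_hull:
  fixes u :: "nat \<Rightarrow> 'v::banach"
  assumes r: "0 < r" "r < 1" and u: "\<And>i. norm (u i) \<le> M"
  obtains a where "(\<lambda>i. (r * (1 - r) ^ i) *\<^sub>R u i) sums a" "norm a \<le> M"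
    "a \<in> closure (convex hull range u)"
proof -
  let ?w = "\<lambda>i. r * (1 - r) ^ i"
  have pow: "(\<lambda>k. (1 - r) ^ k) \<longlonglongrightarrow> 0" using r by (intro LIMSEQ_realpow_zero) auto
  have "(\<lambda>k. 1 - (1 - r) ^ k) \<longlonglongrightarrow> 1 - 0" by (intro tendsto_intros pow)
  then have w: "?w sums 1" by (simp add: sums_def geometric_weights_sum)
  have wM: "(\<lambda>i. ?w i * M) sums M" using sums_mult2[OF w, of M] by simp
  have le: "norm (?w i *\<^sub>R u i) \<le> ?w i * M" for i
    using r u[of i] by (auto intro!: mult_left_mono)
  have sn: "summable (\<lambda>i. norm (?w i *\<^sub>R u i))"
    by (rule summable_comparison_test[OF _ sums_summable[OF wM]]) (use le in auto)
  define a where "a = (\<Sum>i. ?w i *\<^sub>R u i)"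
  have a: "(\<lambda>i. ?w i *\<^sub>R u i) sums a"
    unfolding a_def by (rule summable_sums[OF summable_norm_cancel[OF sn]])
  have "norm a \<le> (\<Sum>i. norm (?w i *\<^sub>R u i))" unfolding a_def by (rule summable_norm[OF sn])
  also have "\<dots> \<le> M" using suminf_le[OF le sn sums_summable[OF wM]] sums_unique[OF wM] by simp
  finally have norm_a: "norm a \<le> M" .
  \<comment> \<open>Partial sums become convex combinations after division by their total weight;
    \<open>Suc k\<close> excludes the empty sum, whose weight is 0. The weights tend to 1, so the
    limit is still \<open>a\<close>.\<close>
  define v where "v k = inverse (1 - (1 - r) ^ Suc k) *\<^sub>R (\<Sum>i<Suc k. ?w i *\<^sub>R u i)" for k
  have "(\<lambda>k. inverse (1 - (1 - r) ^ Suc k) *\<^sub>R (\<Sum>i<Suc k. ?w i *\<^sub>R u i)) \<longlonglongrightarrow> inverse (1 - 0) *\<^sub>R a"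
    using a by (intro tendsto_intros LIMSEQ_Suc[OF pow] LIMSEQ_Suc[of "\<lambda>k. \<Sum>i<k. ?w i *\<^sub>R u i"])
      (auto simp: sums_def)
  then have "v \<longlonglongrightarrow> a" by (simp add: v_def[abs_def])
  moreover have "v k \<in> convex hull range u" for k
  proof -
    have "(1 - r) ^ Suc k < 1" using r by (intro power_Suc_less_one) auto
    then have pos: "0 < 1 - (1 - r) ^ Suc k" by simp
    have "(\<Sum>i<Suc k. (inverse (1 - (1 - r) ^ Suc k) * ?w i) *\<^sub>R u i) \<in> convex hull range u"
    proof (rule convex_sum)
      show "(\<Sum>i<Suc k. inverse (1 - (1 - r) ^ Suc k) * ?w i) = 1"
        using pos by (subst sum_distrib_left[symmetric], subst geometric_weights_sum) simp
      show "0 \<le> inverse (1 - (1 - r) ^ Suc k) * ?w i" for i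
        using pos r by (intro mult_nonneg_nonneg) auto
    qed (auto intro: hull_inc)
    then show ?thesis by (simp only: v_def scaleR_sum_right scaleR_scaleR)
  qed
  ultimately have "a \<in> closure (convex hull range u)"
    unfolding closure_sequential by blast
  with a norm_a show ?thesis by (rule that)
qed

section \<open>Recursive choice of the sequence and properties of the limit maps\<close>

context cohen_iteration
begin

text \<open>Dependent choice of triples: an index, the part \<open>c\<close> of the k-th element
  without its unit term, and the inverse. The range \<open>N k\<close> of controlled exponents is
  left free; the growth bound dictates it later.\<close>

lemma iteration_sequence:
  fixes N :: "nat \<Rightarrow> nat"
  assumes \<eta>: "0 < \<eta>"
  obtains l :: "nat \<Rightarrow> 'l" and c :: "nat \<Rightarrow> 'a" and bi :: "nat \<Rightarrow> 'b" where
    "c 0 = 0" "bi 0 = 1"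
    "\<And>k. c (Suc k) = c k + (r * (1 - r) ^ k) *\<^sub>R e (l (Suc k))"
    "\<And>k. l k \<le> l (Suc k)" "\<And>k. (\<nexists>m :: 'l. \<forall>j. j \<le> m) \<Longrightarrow> l k < l (Suc k)"
    "\<And>k. ((1 - r) ^ k *\<^sub>R 1 + \<iota> (c k)) * bi k = 1" "\<And>k. bi k * ((1 - r) ^ k *\<^sub>R 1 + \<iota> (c k)) = 1"
    "\<And>k. norm (bi k) \<le> \<kappa> ^ k"
    "\<And>k A. closed_unital_subalgebra A \<Longrightarrow> \<iota> (c k) \<in> A \<Longrightarrow> \<iota> (e (l (Suc k))) \<in> A \<Longrightarrow> bi k \<in> A
      \<Longrightarrow> bi (Suc k) \<in> A"
    "\<And>k n. fixed_in_limit (bi k ^ n)"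
    "\<And>k n s. n \<le> N k \<Longrightarrow> s \<in> T \<Longrightarrow> norm (\<sigma> (bi (Suc k) ^ n) s - \<sigma> (bi k ^ n) s) \<le> \<eta> / 2 ^ Suc k"
proof -
  \<comment> \<open>In the commutative case, commutation of \<open>c\<close> with every
    \<open>e l\<close> is carried along, because the powers of the next inverse are uniformly fixed
    on account of it.\<close>
  define P where "P k x \<longleftrightarrow> (case x of (l :: 'l, c, bi) \<Rightarrow>
      ((1 - r) ^ k *\<^sub>R 1 + \<iota> c) * bi = 1 \<and> bi * ((1 - r) ^ k *\<^sub>R 1 + \<iota> c) = 1 \<and> norm bi \<le> \<kappa> ^ k
      \<and> ((\<forall>l m. e l * e m = e m * e l) \<longrightarrow> (\<forall>l. e l * c = c * e l)) \<and> (k = 0 \<longrightarrow> c = 0 \<and> bi = 1))" for k x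
  define Q where "Q k x y \<longleftrightarrow> (case (x, y) of ((l :: 'l, c, bi), (l', c', bi')) \<Rightarrow>
      c' = c + (r * (1 - r) ^ k) *\<^sub>R e l' \<and> l \<le> l' \<and> ((\<nexists>m :: 'l. \<forall>j. j \<le> m) \<longrightarrow> l < l')
      \<and> (\<forall>A. closed_unital_subalgebra A \<longrightarrow> \<iota> c \<in> A \<longrightarrow> \<iota> (e l') \<in> A \<longrightarrow> bi \<in> A \<longrightarrow> bi' \<in> A)
      \<and> (\<forall>n\<le>N k. \<forall>s\<in>T. norm (\<sigma> (bi' ^ n) s - \<sigma> (bi ^ n) s) \<le> \<eta> / 2 ^ Suc k))" for k x y
  have "\<exists>f. \<forall>k. P k (f k) \<and> Q k (f k) (f (Suc k))"
  proof (rule dependent_nat_choice)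
    \<comment> \<open>The index at 0 is arbitrary: the sums begin with
      \<open>e (l 1)\<close>.\<close>
    show "\<exists>x. P 0 x" by (intro exI[of _ "(undefined, 0, 1)"]) (simp add: P_def \<iota>_simps)
    show "\<exists>y. P (Suc k) y \<and> Q k x y" if "P k x" for x k
    proof -
      obtain l c bi where x: "x = (l, c, bi)" by (cases x)
      have b: "((1 - r) ^ k *\<^sub>R 1 + \<iota> c) * bi = 1" "bi * ((1 - r) ^ k *\<^sub>R 1 + \<iota> c) = 1"
        and norm_bi: "norm bi \<le> \<kappa> ^ k"
        and comm: "(\<forall>l m. e l * e m = e m * e l) \<Longrightarrow> (\<forall>l. e l * c = c * e l)"
        using that by (auto simp: P_def x)
      have t: "0 < (1 - r) ^ k" "(1 - r) ^ k \<le> 1" "1 \<le> \<kappa> ^ k" "0 < \<eta> / 2 ^ Suc k"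
        using r r_less_1 \<kappa>_ge_2 \<eta> by (auto intro: power_le_one)
      obtain l' where ll': "l \<le> l'" "(\<nexists>m :: 'l. \<forall>j. j \<le> m) \<longrightarrow> l < l'"
        and "\<exists>bi'. (((1 - r) * (1 - r) ^ k) *\<^sub>R 1 + \<iota> (c + (r * (1 - r) ^ k) *\<^sub>R e l')) * bi' = 1
          \<and> bi' * (((1 - r) * (1 - r) ^ k) *\<^sub>R 1 + \<iota> (c + (r * (1 - r) ^ k) *\<^sub>R e l')) = 1
          \<and> norm bi' \<le> \<kappa> * \<kappa> ^ k
          \<and> (\<forall>A. closed_unital_subalgebra A \<longrightarrow> \<iota> c \<in> A \<longrightarrow> \<iota> (e l') \<in> A \<longrightarrow> bi \<in> A \<longrightarrow> bi' \<in> A)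
          \<and> (\<forall>n\<le>N k. \<forall>s\<in>T. norm (\<sigma> (bi' ^ n) s - \<sigma> (bi ^ n) s) \<le> \<eta> / 2 ^ Suc k)"
        using iteration_step[OF b t(1,2) comm norm_bi t(3,4)] by (rule eventually_tails_above)
      then obtain bi' where bi':
        "(((1 - r) * (1 - r) ^ k) *\<^sub>R 1 + \<iota> (c + (r * (1 - r) ^ k) *\<^sub>R e l')) * bi' = 1"
        "bi' * (((1 - r) * (1 - r) ^ k) *\<^sub>R 1 + \<iota> (c + (r * (1 - r) ^ k) *\<^sub>R e l')) = 1"
        "norm bi' \<le> \<kappa> * \<kappa> ^ k"
        "\<forall>A. closed_unital_subalgebra A \<longrightarrow> \<iota> c \<in> A \<longrightarrow> \<iota> (e l') \<in> A \<longrightarrow> bi \<in> A \<longrightarrow> bi' \<in> A"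
        "\<forall>n\<le>N k. \<forall>s\<in>T. norm (\<sigma> (bi' ^ n) s - \<sigma> (bi ^ n) s) \<le> \<eta> / 2 ^ Suc k" by blast
      have "P (Suc k) (l', c + (r * (1 - r) ^ k) *\<^sub>R e l', bi')"
        unfolding P_def using bi'(1-3) comm by (simp add: distrib_left distrib_right)
      moreover have "Q k x (l', c + (r * (1 - r) ^ k) *\<^sub>R e l', bi')"
        unfolding Q_def x using bi'(4,5) ll' by simp
      ultimately show ?thesis by blast
    qed
  qed
  then obtain f where f: "\<And>k. P k (f k)" "\<And>k. Q k (f k) (f (Suc k))" by blast
  define l where "l k = fst (f k)" for k
  define c where "c k = fst (snd (f k))" for k
  define bi where "bi k = snd (snd (f k))" for k
  have f_eq: "f k = (l k, c k, bi k)" for k by (simp add: l_def c_def bi_def)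
  note P = f(1)[unfolded P_def f_eq prod.case] and Q = f(2)[unfolded Q_def f_eq prod.case]
  show ?thesis
  proof (rule that[of c bi l])
    fix k n
    have "(1 - r) ^ k \<noteq> 0" using r_less_1 by simp
    then show "fixed_in_limit (bi k ^ n)" using P[of k] by (intro fixed_in_limit_inverse_power) auto
  qed (use P Q in blast)+
qed


theorem power_factorization:
  fixes scB :: "'f::real_or_complex \<Rightarrow> 'b \<Rightarrow> 'b" and scY :: "'f \<Rightarrow> 'y \<Rightarrow> 'y" and \<alpha> :: "nat \<Rightarrow> real"
  assumes scB: "normed_scaling scB" and scY: "normed_scaling scY"
    and \<sigma>_linear: "\<And>b. Vector_Spaces.linear scY scY (\<sigma> b)"
    and \<epsilon>: "0 < \<epsilon>" and \<delta>: "0 < \<delta>"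
    and \<alpha>_gt_1: "\<And>n. 1 \<le> n \<Longrightarrow> 1 < \<alpha> n" and \<alpha>_at_top: "filterlim \<alpha> at_top sequentially"
  shows "\<exists>a x. simultaneous_power_factorization scB scY e M \<iota> \<sigma> T \<epsilon> \<delta> r n\<^sub>0 \<alpha> a x"
proof -
  \<comment> \<open>\<open>C * \<kappa> ^ k\<close> bounds the norm of \<open>\<sigma>\<close> at
    the k-th inverse; the extra 1 leaves room for the error \<open>\<eta>\<close>.\<close>
  have "\<exists>m. \<forall>n\<ge>m. C * \<kappa> ^ k + 1 \<le> \<alpha> n" for k
    using \<alpha>_at_top by (auto simp: filterlim_at_top eventually_sequentially)
  then obtain m where m: "\<And>k n. m k \<le> n \<Longrightarrow> C * \<kappa> ^ k + 1 \<le> \<alpha> n" by metis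
  \<comment> \<open>Step \<open>k\<close> controls the exponents \<open>n \<le> N k\<close>; for \<open>n > N k\<close> the bound \<open>m\<close> at \<open>Suc k\<close> applies.\<close>
  define N where "N k = n\<^sub>0 + k + (\<Sum>j\<le>Suc k. m j)" for k
  have N_mono: "N i \<le> N j" if "i \<le> j" for i j
    using that unfolding N_def by (intro add_mono sum_mono2) auto
  have N_ge: "n\<^sub>0 \<le> N k" "k \<le> N k" "m (Suc k) \<le> N k" for k
    by (auto simp: N_def)
  \<comment> \<open>The least slack \<open>\<alpha> n - 1\<close> over the exponents controlled from
    step 0, capped at 1. Then \<open>\<eta> \<le> \<epsilon>\<close> yields closeness to s, and
    \<open>\<eta> \<le> \<delta> * \<theta>\<close> yields the growth bound for n \<le>
    \<open>N 0\<close> as well as \<open>\<eta> \<le> \<delta>\<close>, used for the other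
    n.\<close>
  define \<theta> where "\<theta> = Min (insert 1 ((\<lambda>n. \<alpha> n - 1) ` {1..N 0}))"
  have \<theta>: "0 < \<theta>" "\<theta> \<le> 1" "\<And>n. 1 \<le> n \<Longrightarrow> n \<le> N 0 \<Longrightarrow> \<theta> \<le> \<alpha> n - 1"
    using \<alpha>_gt_1 by (auto simp only: \<theta>_def Min_gr_iff intro!: Min_le) auto
  define \<eta> where "\<eta> = min \<epsilon> (\<delta> * \<theta>)"
  have \<eta>: "0 < \<eta>" "\<eta> \<le> \<epsilon>" "\<eta> \<le> \<delta> * \<theta>"
    using \<epsilon> \<delta> \<theta> by (auto simp: \<eta>_def)
  obtain l :: "nat \<Rightarrow> 'l" and c :: "nat \<Rightarrow> 'a" and bi :: "nat \<Rightarrow> 'b" where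
    c0: "c 0 = 0" and bi0: "bi 0 = 1"
    and c_Suc: "\<And>k. c (Suc k) = c k + (r * (1 - r) ^ k) *\<^sub>R e (l (Suc k))"
    and l: "\<And>k. l k \<le> l (Suc k)" "\<And>k. (\<nexists>m :: 'l. \<forall>j. j \<le> m) \<Longrightarrow> l k < l (Suc k)"
    and b_bi: "\<And>k. ((1 - r) ^ k *\<^sub>R 1 + \<iota> (c k)) * bi k = 1"
    and bi_b: "\<And>k. bi k * ((1 - r) ^ k *\<^sub>R 1 + \<iota> (c k)) = 1"
    and norm_bi: "\<And>k. norm (bi k) \<le> \<kappa> ^ k"
    and bi_Suc_mem: "\<And>k A. closed_unital_subalgebra A \<Longrightarrow> \<iota> (c k) \<in> A \<Longrightarrow> \<iota> (e (l (Suc k))) \<in> A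
      \<Longrightarrow> bi k \<in> A \<Longrightarrow> bi (Suc k) \<in> A"
    and fixed: "\<And>k n. fixed_in_limit (bi k ^ n)"
    and step: "\<And>k n s. n \<le> N k \<Longrightarrow> s \<in> T \<Longrightarrow>
      norm (\<sigma> (bi (Suc k) ^ n) s - \<sigma> (bi k ^ n) s) \<le> \<eta> / 2 ^ Suc k"
    by (rule iteration_sequence[OF \<eta>(1), of N]) (rule that; assumption)
  define u where "u k = e (l k)" for k
  define b where "b k = (1 - r) ^ k *\<^sub>R 1 + \<iota> (c k)" for k
  have c_sum: "c k = (\<Sum>i<k. (r * (1 - r) ^ i) *\<^sub>R u (Suc i))" for k
    by (induction k) (auto simp: c0 c_Suc u_def)
  have \<iota>_c: "\<iota> (c k) = (\<Sum>i=1..k. (r * (1 - r) ^ (i - 1)) *\<^sub>R \<iota> (u i))" for k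
    by (induction k) (auto simp: c0 c_Suc u_def \<iota>_simps)
  obtain a where a: "(\<lambda>i. (r * (1 - r) ^ i) *\<^sub>R u (Suc i)) sums a" "norm a \<le> M"
    "a \<in> closure (convex hull range (\<lambda>i. u (Suc i)))"
    using geometric_series_closure_convex_hull[of r "\<lambda>i. u (Suc i)" M] r r_less_1 norm_e
    by (auto simp: u_def)
  have range_u: "range (\<lambda>i. u (Suc i)) = u ` {1..}"
    by (auto simp: image_iff) (metis Suc_le_D One_nat_def)

  define x where "x n s = lim (\<lambda>k. \<sigma> (bi k ^ n) s)" for n s
  \<comment> \<open>As \<open>k \<le> N k\<close>, exponent n is controlled from step n on. In
    \<open>x_close\<close>, monotonicity of \<open>N\<close> keeps n controlled at every step after
    the first k with \<open>n \<le> N k\<close>.\<close>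
  have x_limit: "uniform_limit T (\<lambda>k s. \<sigma> (bi k ^ n) s) (x n) sequentially" for n
    unfolding x_def
    by (rule uniform_limit_geometric_increments(1)[of n _ _ \<eta>])
      (use step[OF order_trans[OF _ N_ge(2)]] \<eta>(1) in auto)
  have x_close: "norm (x n s - \<sigma> (bi k ^ n) s) \<le> \<eta>" if "n \<le> N k" "s \<in> T" for n k s
    unfolding x_def
    by (rule uniform_limit_geometric_increments(2)[where T = T])
      (use step[OF order_trans[OF that(1) N_mono]] that(2) \<eta>(1) in auto)
  have x_tendsto: "(\<lambda>k. \<sigma> (bi k ^ n) s) \<longlonglongrightarrow> x n s" if "s \<in> T" for n s
    using tendsto_uniform_limitI[OF x_limit that] .
  have x_close_0: "norm (x n s - s) \<le> \<eta>" if "n \<le> N 0" "s \<in> T" for n s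
    using x_close[OF that] by (simp add: bi0 \<sigma>_1)

  \<comment> \<open>The unit parts \<open>(1 - r) ^ k\<close> vanish, so \<open>b\<close> tends to
    \<open>\<iota> a\<close>. Application of operators is jointly continuous, hence
    \<open>\<sigma> (b k ^ n) (\<sigma> (bi k ^ n) s)\<close>, which is constantly s, converges to
    \<open>\<sigma> (\<iota> a ^ n) (x n s)\<close>.\<close>
  have factor: "\<sigma> (\<iota> a ^ n) (x n s) = s" if s: "s \<in> T" for n s
  proof -
    have "c \<longlonglongrightarrow> a" using a(1) unfolding sums_def c_sum[abs_def] .
    then have "b \<longlonglongrightarrow> 0 *\<^sub>R 1 + \<iota> a"
      unfolding b_def using r r_less_1
      by (intro tendsto_intros LIMSEQ_realpow_zero bounded_linear.tendsto[OF linear_\<iota>]) auto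
    then have "(\<lambda>k. \<sigma> (b k ^ n)) \<longlonglongrightarrow> \<sigma> (\<iota> a ^ n)"
      by (intro bounded_linear.tendsto[OF linear_\<sigma>] tendsto_power) simp
    then have "(\<lambda>k. \<sigma> (b k ^ n) (\<sigma> (bi k ^ n) s)) \<longlonglongrightarrow> \<sigma> (\<iota> a ^ n) (x n s)"
      by (intro blinfun.tendsto x_tendsto s)
    moreover have "\<sigma> (b k ^ n) (\<sigma> (bi k ^ n) s) = s" for k
      using left_right_inverse_power[OF b_bi[of k], of n]
      by (simp add: b_def \<sigma>_1 flip: \<sigma>_mult blinfun_apply_blinfun_compose)
    ultimately have "(\<lambda>k. s) \<longlonglongrightarrow> \<sigma> (\<iota> a ^ n) (x n s)" by simp
    then show ?thesis by (rule LIMSEQ_unique[OF _ tendsto_const])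
  qed
  have uc: "uniformly_continuous_on T (x n)" for n
    by (rule uniform_limit_uniformly_continuous_on[OF x_limit])
      (intro bounded_linear.uniformly_continuous_on[OF blinfun.bounded_linear_right]
        uniformly_continuous_on_id)
  have homeo: "homeomorphism T (x n ` T) (x n) (\<sigma> (\<iota> a ^ n))" for n
    unfolding homeomorphism_def using factor
    by (auto simp: uniformly_continuous_imp_continuous[OF uc] image_iff
        intro!: linear_continuous_on blinfun.bounded_linear_right)

  have bound: "norm (x n s) \<le> \<alpha> n ^ n * max (norm s) \<delta>" if n: "1 \<le> n" and s: "s \<in> T" for n s
  proof (cases "n \<le> N 0")
    case True
    have "norm (x n s) \<le> norm s + \<eta>"
      using x_close_0[OF True s] norm_triangle_ineq2[of "x n s" s] by simp
    also have "\<eta> \<le> \<delta> * (\<alpha> n - 1)"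
      by (rule order_trans[OF \<eta>(3) mult_left_mono[OF \<theta>(3)]]) (use True n \<delta> in auto)
    also have "\<delta> * (\<alpha> n - 1) \<le> max (norm s) \<delta> * (\<alpha> n - 1)"
      using \<alpha>_gt_1[OF n] by (intro mult_right_mono) auto
    finally have "norm (x n s) \<le> \<alpha> n * max (norm s) \<delta>" by (simp add: algebra_simps)
    also have "\<dots> \<le> \<alpha> n ^ n * max (norm s) \<delta>"
      using \<alpha>_gt_1[OF n] n \<delta> by (intro mult_right_mono self_le_power) auto
    finally show ?thesis .
  next
    case False
    \<comment> \<open>The first step that controls n. Minimality puts n above
      \<open>N (k - 1)\<close>, hence above \<open>m k\<close>, so \<open>\<alpha> n\<close> is at
      least \<open>C * \<kappa> ^ k + 1\<close>; and \<open>n \<le> N k\<close> keeps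
      \<open>x n s\<close> within \<open>\<eta>\<close> of
      \<open>\<sigma> (bi k ^ n) s\<close>.\<close>
    define k where "k = (LEAST k. n \<le> N k)"
    have k: "n \<le> N k" unfolding k_def by (rule LeastI[of _ n]) (rule N_ge)
    with False obtain j where j: "k = Suc j" by (cases k) auto
    have "\<not> n \<le> N j" using not_less_Least[of j "\<lambda>k. n \<le> N k"] j by (simp add: k_def)
    then have \<alpha>n: "C * \<kappa> ^ k + 1 \<le> \<alpha> n" using N_ge(3)[of j] j by (intro m) simp
    have "norm (x n s) \<le> norm (\<sigma> (bi k ^ n) s) + \<eta>"
      using x_close[OF k s] norm_triangle_ineq2[of "x n s" "\<sigma> (bi k ^ n) s"] by simp
    also have "norm (\<sigma> (bi k ^ n) s) \<le> (C * \<kappa> ^ k) ^ n * norm s"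
    proof -
      have "norm (bi k ^ n) \<le> (\<kappa> ^ k) ^ n"
        by (rule order_trans[OF norm_power_ineq power_mono[OF norm_bi]]) simp
      then have "C * norm (bi k ^ n) \<le> C ^ n * (\<kappa> ^ k) ^ n"
        using C n by (intro mult_mono self_le_power) auto
      then show ?thesis
        by (intro order_trans[OF norm_\<sigma>_apply mult_right_mono]) (auto simp: power_mult_distrib)
    qed
    also have "\<dots> \<le> (C * \<kappa> ^ k) ^ n * max (norm s) \<delta>"
      using C \<kappa>_ge_2 by (intro mult_left_mono) auto
    also have "\<eta> \<le> max (norm s) \<delta>"
      using \<eta>(3) mult_left_mono[OF \<theta>(2), of \<delta>] \<delta> by linarith
    finally have "norm (x n s) \<le> ((C * \<kappa> ^ k) ^ n + 1) * max (norm s) \<delta>"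
      by (simp add: distrib_right)
    also have "(C * \<kappa> ^ k) ^ n + 1 \<le> (C * \<kappa> ^ k + 1) ^ n"
      using C \<kappa>_ge_2 n by (intro power_plus_one_le) auto
    also have "\<dots> \<le> \<alpha> n ^ n" using \<alpha>n C \<kappa>_ge_2 by (intro power_mono) auto
    finally show ?thesis using \<delta> by (simp add: mult_right_mono)
  qed

  have add: "x n (s + s') = x n s + x n s'" if "s \<in> T" "s' \<in> T" "s + s' \<in> T" for n s s'
    using x_tendsto[OF that(3), of n] tendsto_add[OF x_tendsto[OF that(1)] x_tendsto[OF that(2)], of n]
    by (simp add: blinfun.add_right LIMSEQ_unique)
  have scale: "x n (scY \<mu> s) = scY \<mu> (x n s)" if "s \<in> T" "scY \<mu> s \<in> T" for n \<mu> s
    using x_tendsto[OF that(2), of n]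
      bounded_linear.tendsto[OF normed_scaling_bounded_linear[OF scY] x_tendsto[OF that(1)], of \<mu> n]
    by (simp add: module_hom.scale[OF Vector_Spaces.linear.axioms(3)[OF \<sigma>_linear]] LIMSEQ_unique)

  have b_hull: "b k \<in> convex hull (insert 1 ((\<lambda>i. \<iota> (u i)) ` {1..k}))" for k
  proof -
    \<comment> \<open>Place 0 carries the unit, place i \<ge> 1 carries \<open>u i\<close> with
      weight \<open>r * (1 - r) ^ (i - 1)\<close>.\<close>
    define w where "w = case_nat ((1 - r) ^ k) (\<lambda>i. r * (1 - r) ^ i)"
    define y where "y = case_nat 1 (\<lambda>i. \<iota> (u (Suc i)))"
    have "(\<Sum>i\<le>k. w i *\<^sub>R y i) \<in> convex hull (insert 1 ((\<lambda>i. \<iota> (u i)) ` {1..k}))"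
    proof (rule convex_sum)
      show "(\<Sum>i\<le>k. w i) = 1"
        using geometric_weights_sum[of r k] by (simp add: w_def sum.atMost_shift)
      show "0 \<le> w i" for i using r r_less_1 by (auto simp: w_def split: nat.split)
      show "y i \<in> convex hull (insert 1 ((\<lambda>i. \<iota> (u i)) ` {1..k}))" if "i \<in> {..k}" for i
        using that by (cases i) (auto simp: y_def intro!: hull_inc)
    qed auto
    moreover have "(\<Sum>i\<le>k. w i *\<^sub>R y i) = b k"
      by (simp add: b_def \<iota>_c sum.atMost_shift w_def y_def sum.atLeast1_atMost_eq)
    ultimately show ?thesis by simp
  qed
  have bi_mem: "bi k \<in> A"
    if A: "closed_unital_subalgebra A" and uA: "\<And>i. 1 \<le> i \<Longrightarrow> i \<le> k \<Longrightarrow> \<iota> (u i) \<in> A" for k A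
    using uA
  proof (induction k)
    case 0
    show ?case using closed_unital_subalgebraD(1)[OF A] by (simp add: bi0)
  next
    case (Suc k)
    have "\<iota> (c k) \<in> A"
      unfolding \<iota>_c using A Suc.prems
      by (intro subspace_sum subspace_scale) (auto simp: closed_unital_subalgebra_def)
    with Suc show ?case by (intro bi_Suc_mem A) (auto simp: u_def)
  qed
  have bi_generated: "bi k \<in> generated_unital_subalgebra scB ((\<lambda>i. \<iota> (u i)) ` {1..k})" for k
    unfolding generated_unital_subalgebra_def
    by (auto intro!: bi_mem simp: closed_unital_subalgebra_def normed_scaling_subspace[OF scB])

  \<comment> \<open>The property passes from \<open>\<sigma> (bi k ^ n) s\<close> to the uniform
    limit because all \<open>\<sigma> (\<iota> (e j))\<close> have norm at most
    \<open>C * M\<close>; this accounts for the divisor \<open>C * M + 2\<close>.\<close>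
  have x_fixed: "uniform_limit T (\<lambda>j s. \<sigma> (\<iota> (e j)) (x n s)) (x n) tails" for n
  proof (rule uniform_limitI)
    fix d :: real assume "0 < d"
    define d' where "d' = d / (C * M + 2)"
    have CM: "0 < C * M" using C M by simp
    then have "0 < d'" "(C * M + 2) * d' = d" using \<open>0 < d\<close> by (auto simp: d'_def)
    then have d': "0 < d'" "C * M * d' + 2 * d' = d" by (simp_all only: distrib_right)
    obtain k where k: "\<And>s. s \<in> T \<Longrightarrow> dist (\<sigma> (bi k ^ n) s) (x n s) < d'"
      using uniform_limitD[OF x_limit[of n] d'(1)] by (auto simp: eventually_sequentially)
    show "\<forall>\<^sub>F j in tails. \<forall>s\<in>T. dist (\<sigma> (\<iota> (e j)) (x n s)) (x n s) < d"
      using uniform_limitD[OF fixed[of k n, unfolded fixed_in_limit_def] d'(1)]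
    proof eventually_elim
      case (elim j)
      show ?case
      proof
        fix s assume s: "s \<in> T"
        have "dist (\<sigma> (\<iota> (e j)) (x n s)) (\<sigma> (\<iota> (e j)) (\<sigma> (bi k ^ n) s))
            = norm (\<sigma> (\<iota> (e j)) (x n s - \<sigma> (bi k ^ n) s))"
          by (simp add: dist_norm blinfun.diff_right)
        also have "\<dots> \<le> C * M * d'"
          using C M k[OF s] norm_e
          by (intro order_trans[OF norm_\<sigma>_apply] mult_mono)
            (auto simp: norm_\<iota> dist_norm norm_minus_commute intro: less_imp_le)
        finally show "dist (\<sigma> (\<iota> (e j)) (x n s)) (x n s) < d"
          using elim s k[OF s] d'(2)
            dist_triangle[of "\<sigma> (\<iota> (e j)) (x n s)" "x n s" "\<sigma> (\<iota> (e j)) (\<sigma> (bi k ^ n) s)"]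
            dist_triangle[of "\<sigma> (\<iota> (e j)) (\<sigma> (bi k ^ n) s)" "x n s" "\<sigma> (bi k ^ n) s"]
          by fastforce
      qed
    qed
  qed
  have x_bounded: "bounded (x n ` T)" if "bounded T" "1 \<le> n" for n
  proof -
    obtain K where K: "\<And>s. s \<in> T \<Longrightarrow> norm s \<le> K" using \<open>bounded T\<close> by (auto simp: bounded_iff)
    have "norm (x n s) \<le> \<alpha> n ^ n * max K \<delta>" if s: "s \<in> T" for s
      using K[OF s] \<alpha>_gt_1[OF \<open>1 \<le> n\<close>]
      by (intro order_trans[OF bound[OF \<open>1 \<le> n\<close> s] mult_left_mono]) auto
    then show ?thesis by (auto simp: bounded_iff)
  qed

  have "simultaneous_power_factorization scB scY e M \<iota> \<sigma> T \<epsilon> \<delta> r n\<^sub>0 \<alpha> a x"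
    unfolding simultaneous_power_factorization_def
  proof (intro conjI)
    show "\<forall>n. 1 \<le> n \<and> n \<le> n\<^sub>0 \<longrightarrow> (\<forall>s\<in>T. norm (s - x n s) \<le> \<epsilon>)"
      using x_close_0 \<eta>(2) N_ge(1)[of 0] by (metis norm_minus_commute order_trans)
    show "\<exists>u l b bi. (\<lambda>i. (r * (1 - r) ^ i) *\<^sub>R u (Suc i)) sums a
      \<and> a \<in> closure (convex hull (u ` {1..}))
      \<and> (\<forall>k. b k = (1 - r) ^ k *\<^sub>R 1 + (\<Sum>i=1..k. (r * (1 - r) ^ (i - 1)) *\<^sub>R \<iota> (u i)))
      \<and> (\<forall>k. b k \<in> convex hull (insert 1 ((\<lambda>i. \<iota> (u i)) ` {1..k})))
      \<and> (\<forall>k. b k * bi k = 1 \<and> bi k * b k = 1)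
      \<and> (\<forall>k. bi k \<in> generated_unital_subalgebra scB ((\<lambda>i. \<iota> (u i)) ` {1..k}))
      \<and> (\<forall>n\<ge>1. \<forall>s\<in>T. (\<lambda>k. \<sigma> (bi k ^ n) s) \<longlonglongrightarrow> x n s)
      \<and> (\<forall>k\<ge>1. u k = e (l k))
      \<and> (\<forall>k\<ge>1. l k \<le> l (Suc k))
      \<and> ((\<nexists>m :: 'l. \<forall>j. j \<le> m) \<longrightarrow> (\<forall>k\<ge>1. l k < l (Suc k)))"
      by (rule exI[of _ u], rule exI[of _ l], rule exI[of _ b], rule exI[of _ bi], intro conjI)
        (use a range_u b_hull b_bi bi_b bi_generated x_tendsto l
          in \<open>simp_all add: u_def b_def \<iota>_c\<close>)
  qed (use a factor uc homeo bound add scale x_bounded x_fixed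
      totally_bounded_uniformly_continuous_image[OF uc] in auto)
  then show ?thesis by blast
qed

end

section \<open>From continuous representations over the scalar field to the real setting\<close>

lemma continuous_linear_imp_bounded_linear:
  fixes \<sigma> :: "'b::real_normed_vector \<Rightarrow> 'y::real_normed_vector"
  assumes "linear \<sigma>" and cont: "continuous_on UNIV \<sigma>"
  shows "bounded_linear \<sigma>"
proof -
  interpret linear \<sigma> by fact
  have "isCont \<sigma> 0" using cont by (simp add: continuous_on_eq_continuous_at)
  then obtain d where d: "0 < d" "\<And>b. norm b < d \<Longrightarrow> norm (\<sigma> b) < 1"
    unfolding continuous_at_eps_delta by (auto simp: zero dist_norm dest!: spec[of _ 1])
  have "norm (\<sigma> b) \<le> norm b * (2 / d)" for b
  proof (cases "b = 0")
    case False
    define t where "t = d / (2 * norm b)"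
    have t: "0 < t" using False d by (simp add: t_def)
    have "norm (t *\<^sub>R b) < d" using False d by (simp add: t_def)
    from d(2)[OF this] have "t * norm (\<sigma> b) < 1" using t by (simp add: scaleR)
    then show ?thesis using False d by (simp add: t_def field_simps)
  qed (simp add: zero)
  then show ?thesis by unfold_locales blast
qed

lemma normed_scaling_linear:
  assumes "normed_scaling sc" "normed_scaling sc'" "Vector_Spaces.linear sc sc' h"
  shows "linear h"
proof -
  interpret Vector_Spaces.linear sc sc' h by fact
  have "t *\<^sub>R v = sc (of_real t) v" "t *\<^sub>R w = sc' (of_real t) w" for t v w
    using assms by (auto simp: normed_scaling_def)
  then show ?thesis by (intro linearI) (auto simp: add scale)
qed

text \<open>Restricting scalars to the reals makes \<open>\<iota>\<close> bounded as an isometry and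
  \<open>\<sigma>\<close> bounded by continuity. The field reappears only through \<open>scB\<close>
  and \<open>scY\<close>, for the generated subalgebra and the homogeneity of the maps.\<close>

theorem simultaneous_power_factorization_exists:
  fixes scA :: "'f::real_or_complex \<Rightarrow> 'a::{real_normed_algebra, banach} \<Rightarrow> 'a"
    and scY :: "'f \<Rightarrow> 'y::banach \<Rightarrow> 'y"
    and e :: "'l::directed_preorder \<Rightarrow> 'a"
    and scB :: "'f \<Rightarrow> 'b::{real_normed_algebra_1, banach} \<Rightarrow> 'b"
  assumes scA: "normed_algebra_scaling scA" and scY: "normed_scaling scY"
    and M: "1 \<le> M" and e: "left_approximate_identity e M"
    and \<iota>: "unital_superalgebra scA scB \<iota>"
    and \<sigma>: "continuous_unital_representation scB scY \<sigma>"
    and T: "uniform_limit T (\<lambda>l s. \<sigma> (\<iota> (e l)) s) (\<lambda>s. s) tails"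
    and bc: "bounded T \<or> (\<forall>l m. e l * e m = e m * e l)"
    and "0 < \<epsilon>" "0 < \<delta>" and r: "0 < r" "r < 1 / (M + 1)"
    and "\<And>n. 1 \<le> n \<Longrightarrow> 1 < \<alpha> n" "filterlim \<alpha> at_top sequentially"
  shows "\<exists>a x. simultaneous_power_factorization scB scY e M \<iota> \<sigma> T \<epsilon> \<delta> r n\<^sub>0 \<alpha> a x"
proof -
  have scB: "normed_scaling scB" and \<iota>_linear: "Vector_Spaces.linear scA scB \<iota>"
    and \<iota>_mult: "\<And>a a'. \<iota> (a * a') = \<iota> a * \<iota> a'" and norm_\<iota>: "\<And>a. norm (\<iota> a) = norm a"
    using \<iota> by (auto simp: unital_superalgebra_def normed_algebra_scaling_def)
  have e': "norm (e l) \<le> M" "((\<lambda>l. e l * a) \<longlongrightarrow> a) tails" for l a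
    using e by (simp_all add: left_approximate_identity_def)
  have scA': "normed_scaling scA" using scA by (simp add: normed_algebra_scaling_def)
  have \<sigma>_linear: "\<And>b. Vector_Spaces.linear scY scY (\<sigma> b)" and \<sigma>_add: "\<And>b c. \<sigma> (b + c) = \<sigma> b + \<sigma> c"
    and \<sigma>_scale: "\<And>k b y. \<sigma> (scB k b) y = scY k (\<sigma> b y)" and \<sigma>_mult: "\<And>b c. \<sigma> (b * c) = \<sigma> b o\<^sub>L \<sigma> c"
    and \<sigma>_cont: "continuous_on UNIV \<sigma>" and \<sigma>_1: "\<sigma> 1 = id_blinfun"
    using \<sigma> by (auto simp: continuous_unital_representation_def continuous_representation_def)
  have "\<sigma> (t *\<^sub>R b) = t *\<^sub>R \<sigma> b" for t b
  proof (rule blinfun_eqI)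
    have "t *\<^sub>R b = scB (of_real t) b" "t *\<^sub>R y = scY (of_real t) y" for y
      using scB scY by (auto simp: normed_scaling_def)
    then show "\<sigma> (t *\<^sub>R b) y = (t *\<^sub>R \<sigma> b) y" for y
      by (simp add: \<sigma>_scale blinfun.scaleR_left)
  qed
  then have \<sigma>_bounded: "bounded_linear \<sigma>"
    by (intro continuous_linear_imp_bounded_linear linearI \<sigma>_add \<sigma>_cont)
  then obtain K where K: "\<And>b. norm (\<sigma> b) \<le> norm b * K" using bounded_linear.bounded by blast
  have le: "norm b * K \<le> max 1 K * norm b" for b :: 'b
    by (subst mult.commute) (simp add: mult_right_mono)
  have norm_\<sigma>: "norm (\<sigma> b) \<le> max 1 K * norm b" for b
    by (rule order_trans[OF K le])
  have rM: "r * (M + 1) < 1" using r M by (simp add: field_simps)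
  have \<iota>_bounded: "bounded_linear \<iota>"
  proof -
    interpret L: linear \<iota> by (rule normed_scaling_linear[OF scA' scB \<iota>_linear])
    show ?thesis by (rule bounded_linear_intro[of _ 1]) (simp_all add: L.add L.scaleR norm_\<iota>)
  qed
  interpret cohen_iteration e M r \<iota> \<sigma> T "max 1 K"
    by (rule cohen_iteration.intro)
      (rule M r(1) rM e' \<iota>_bounded \<iota>_mult norm_\<iota> \<sigma>_bounded \<sigma>_mult \<sigma>_1 norm_\<sigma> T bc | simp)+
  show ?thesis by (rule power_factorization) fact+
qed


section \<open>Nets in the set\<close>

lemma bounded_conv_nets_in:
  assumes "bounded S"
  shows "bounded (conv_nets_in S)"
proof -
  obtain K where "\<And>s. s \<in> S \<Longrightarrow> norm s \<le> K" using assms by (auto simp: bounded_iff)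
  then have "norm f \<le> K" if "f \<in> conv_nets_in S" for f
    using that by (intro norm_conv_net_le) (auto simp: conv_nets_in_def)
  then show ?thesis by (auto simp: bounded_iff)
qed

lemma bounded_null_nets_in:
  assumes "bounded S"
  shows "bounded (null_nets_in S)"
proof -
  obtain K where "\<And>s. s \<in> S \<Longrightarrow> norm s \<le> K" using assms by (auto simp: bounded_iff)
  then have "norm f \<le> K" if "f \<in> null_nets_in S" for f
    using that by (intro norm_null_net_le) (auto simp: null_nets_in_def)
  then show ?thesis by (auto simp: bounded_iff)
qed

text \<open>The index given by uniformity on \<open>S\<close> serves all values of all nets in
  \<open>S\<close> at once, so the pointwise errors bound the supremum norm.\<close>

lemma uniform_limit_conv_nets_in:
  fixes P :: "'l \<Rightarrow> 'x::real_normed_vector \<Rightarrow>\<^sub>L 'x"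
  assumes "uniform_limit S (\<lambda>l s. P l s) (\<lambda>s. s) F"
  shows "uniform_limit (conv_nets_in S) (\<lambda>l f. conv_net_op (P l) f) (\<lambda>f. f) F"
proof (rule uniform_limitI)
  fix d :: real assume "0 < d"
  \<comment> \<open>\<open>d / 2\<close>, as passing to the supremum preserves only the weak
    inequality.\<close>
  then have "\<forall>\<^sub>F l in F. \<forall>s\<in>S. dist (P l s) s < d / 2" by (intro uniform_limitD[OF assms]) simp
  then show "\<forall>\<^sub>F l in F. \<forall>f\<in>conv_nets_in S. dist (conv_net_op (P l) f) f < d"
  proof eventually_elim
    case (elim l)
    show ?case
    proof
      fix f assume "f \<in> conv_nets_in S"
      then have "norm (conv_net_op (P l) f - f) \<le> d / 2"
        using elim by (intro norm_conv_net_le)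
          (auto simp: conv_nets_in_def conv_net_rep_eq apply_conv_net_op dist_norm intro: less_imp_le)
      then show "dist (conv_net_op (P l) f) f < d" using \<open>0 < d\<close> by (simp add: dist_norm)
    qed
  qed
qed

lemma uniform_limit_null_nets_in:
  fixes P :: "'l \<Rightarrow> 'x::real_normed_vector \<Rightarrow>\<^sub>L 'x"
  assumes "uniform_limit S (\<lambda>l s. P l s) (\<lambda>s. s) F"
  shows "uniform_limit (null_nets_in S) (\<lambda>l f. null_net_op (P l) f) (\<lambda>f. f) F"
proof (rule uniform_limitI)
  fix d :: real assume "0 < d"
  then have "\<forall>\<^sub>F l in F. \<forall>s\<in>S. dist (P l s) s < d / 2" by (intro uniform_limitD[OF assms]) simp
  then show "\<forall>\<^sub>F l in F. \<forall>f\<in>null_nets_in S. dist (null_net_op (P l) f) f < d"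
  proof eventually_elim
    case (elim l)
    show ?case
    proof
      fix f assume "f \<in> null_nets_in S"
      then have "norm (null_net_op (P l) f - f) \<le> d / 2"
        using elim by (intro norm_null_net_le)
          (auto simp: null_nets_in_def null_net_rep_eq apply_null_net_op dist_norm intro: less_imp_le)
      then show "dist (null_net_op (P l) f) f < d" using \<open>0 < d\<close> by (simp add: dist_norm)
    qed
  qed
qed

theorem theorem6p2:
  fixes scA :: "'f::real_or_complex \<Rightarrow> 'a::{real_normed_algebra, banach} \<Rightarrow> 'a"
    and scX :: "'f \<Rightarrow> 'x::banach \<Rightarrow> 'x"
    and e :: "'l::directed_preorder \<Rightarrow> 'a"
    and M :: real
    and \<pi> :: "'a \<Rightarrow> 'x \<Rightarrow>\<^sub>L 'x"
    and S :: "'x set"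
    and scB :: "'f \<Rightarrow> 'b::{real_normed_algebra_1, banach} \<Rightarrow> 'b"
    and \<iota> :: "'a \<Rightarrow> 'b"
    and \<epsilon> \<delta> r :: real and n\<^sub>0 :: nat and \<alpha> :: "nat \<Rightarrow> real"
  assumes "normed_algebra_scaling scA"
    and "normed_scaling scX"
    and "M \<ge> 1"
    and "left_approximate_identity e M"
    and "continuous_representation scA scX \<pi>"
    and "S \<noteq> {}"
    and "uniform_limit S (\<lambda>l s. \<pi> (e l) s) (\<lambda>s. s) tails"
    and "bounded S \<or> (\<forall>l m. e l * e m = e m * e l)"
    and "unital_superalgebra scA scB \<iota>"
    and "\<epsilon> > 0" and "\<delta> > 0" and "0 < r" and "r < 1 / (M + 1)" and "n\<^sub>0 \<ge> 1"
    and "\<forall>n\<ge>1. \<alpha> n > 1" and "filterlim \<alpha> at_top sequentially"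
  shows
    "(\<forall>\<sigma> :: 'b \<Rightarrow> ('w::directed_preorder, 'x) conv_net \<Rightarrow>\<^sub>L ('w, 'x) conv_net.
        continuous_unital_representation scB (conv_net_scale scX) \<sigma>
        \<and> (\<forall>a. \<sigma> (\<iota> a) = conv_net_op (\<pi> a)) \<longrightarrow>
        (\<exists>a x. simultaneous_power_factorization scB (conv_net_scale scX) e M \<iota> \<sigma>
                 (conv_nets_in S) \<epsilon> \<delta> r n\<^sub>0 \<alpha> a x))
     \<and>
     (0 \<in> closure S \<longrightarrow>
      (\<forall>\<sigma> :: 'b \<Rightarrow> ('w, 'x) null_net \<Rightarrow>\<^sub>L ('w, 'x) null_net.
        continuous_unital_representation scB (null_net_scale scX) \<sigma>
        \<and> (\<forall>a. \<sigma> (\<iota> a) = null_net_op (\<pi> a)) \<longrightarrow>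
        (\<exists>a x. simultaneous_power_factorization scB (null_net_scale scX) e M \<iota> \<sigma>
                 (null_nets_in S) \<epsilon> \<delta> r n\<^sub>0 \<alpha> a x)))"
proof (intro conjI impI allI; (elim conjE)?)
  fix \<sigma> :: "'b \<Rightarrow> ('w, 'x) conv_net \<Rightarrow>\<^sub>L ('w, 'x) conv_net"
  assume \<sigma>: "continuous_unital_representation scB (conv_net_scale scX) \<sigma>"
    and ext: "\<forall>a. \<sigma> (\<iota> a) = conv_net_op (\<pi> a)"
  show "\<exists>a x. simultaneous_power_factorization scB (conv_net_scale scX) e M \<iota> \<sigma>
      (conv_nets_in S) \<epsilon> \<delta> r n\<^sub>0 \<alpha> a x"
  proof (rule simultaneous_power_factorization_exists[OF assms(1) normed_scaling_conv_net[OF assms(2)]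
        assms(3,4,9) \<sigma> _ _ assms(10-13)])
    \<comment> \<open>As \<open>\<sigma>\<close> extends the pointwise action, convergence reduces
      to that of \<open>\<pi> (e l)\<close> on \<open>S\<close>. Boundedness passes from
      \<open>S\<close> to its nets, and commutativity concerns \<open>e\<close> alone.\<close>
    show "uniform_limit (conv_nets_in S) (\<lambda>l s. \<sigma> (\<iota> (e l)) s) (\<lambda>s. s) tails"
      using uniform_limit_conv_nets_in[OF assms(7)] ext by simp
    show "bounded (conv_nets_in S :: ('w, 'x) conv_net set) \<or> (\<forall>l m. e l * e m = e m * e l)"
      using assms(8) bounded_conv_nets_in by blast
  qed (use assms in auto)
next
  fix \<sigma> :: "'b \<Rightarrow> ('w, 'x) null_net \<Rightarrow>\<^sub>L ('w, 'x) null_net"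
  assume \<sigma>: "continuous_unital_representation scB (null_net_scale scX) \<sigma>"
    and ext: "\<forall>a. \<sigma> (\<iota> a) = null_net_op (\<pi> a)"
  show "\<exists>a x. simultaneous_power_factorization scB (null_net_scale scX) e M \<iota> \<sigma>
      (null_nets_in S) \<epsilon> \<delta> r n\<^sub>0 \<alpha> a x"
  proof (rule simultaneous_power_factorization_exists[OF assms(1) normed_scaling_null_net[OF assms(2)]
        assms(3,4,9) \<sigma> _ _ assms(10-13)])
    show "uniform_limit (null_nets_in S) (\<lambda>l s. \<sigma> (\<iota> (e l)) s) (\<lambda>s. s) tails"
      using uniform_limit_null_nets_in[OF assms(7)] ext by simp
    show "bounded (null_nets_in S :: ('w, 'x) null_net set) \<or> (\<forall>l m. e l * e m = e m * e l)"
      using assms(8) bounded_null_nets_in by blast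
  qed (use assms in auto)
qed

end
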